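(* Let $u,k,v_1,v_2,\ldots,v_k\in\mathbb{N}$ with $k\geq 2$. For each $t\in\{1,2,\ldots,k\}$, let $A_t$ be a $u\times v_t$ matrix with entries from $\mathbb{Q}$. Then $(A_1,A_2,\ldots,A_k)$ is multiply kernel partition regular if and only if there exist positive rationals $c_2,c_3,\ldots,c_k$ such that the $u\times(v_1+\cdots+v_k)$ block matrix $(\,A_1\ \ c_2A_2\ \ c_3A_3\ \ \ldots\ \ c_kA_k\,)$ is kernel partition regular.
   Context: $\mathbb{N}$ denotes the set of positive integers. A finite colouring of $\mathbb{N}$ is a map $\varphi:\mathbb{N}\to\{1,\ldots,r\}$ for some $r\in\mathbb{N}$; a vector is monochromatic if $\varphi$ is constant on its entries. A $u\times v$ matrix $M$ with rational entries is kernel partition regular (KPR) if whenever $\mathbb{N}$ is finitely coloured there exists a monochromatic $\vec x\in\mathbb{N}^v$ with $M\vec x=\vec 0$. A tuple $(A_1,\ldots,A_k)$ ($k\ge2$) of rational matrices, $A_t$ of size $u\times v_t$, is multiply kernel partition regular if whenever $\mathbb{N}$ is finitely coloured there exist, for each $t$, monochromatic $\vec x_t\in\mathbb{N}^{v_t}$ (different $\vec x_t$ may have different colours) such that $A_1\vec x_1+A_2\vec x_2+\cdots+A_k\vec x_k=\vec 0$. *)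

theory Defs
  imports "Jordan_Normal_Form.Matrix"
begin

text \<open>The paper's \<open>\<nat>\<close> is the set of positive integers. A colouring is a function on
  the type \<^typ>\<open>nat\<close> whose value at \<open>0\<close> is irrelevant.\<close>

definition finite_colouring :: "nat \<Rightarrow> (nat \<Rightarrow> nat) \<Rightarrow> bool" where
  "finite_colouring r \<phi> \<longleftrightarrow> 0 < r \<and> \<phi> \<in> {1..} \<rightarrow> {1..r}"

definition positive_vec :: "nat vec \<Rightarrow> bool" where
  "positive_vec x \<longleftrightarrow> (\<forall>i<dim_vec x. 0 < x $ i)"

definition monochromatic :: "(nat \<Rightarrow> nat) \<Rightarrow> nat vec \<Rightarrow> bool" where
  "monochromatic \<phi> x \<longleftrightarrow> (\<exists>a. \<forall>i<dim_vec x. \<phi> (x $ i) = a)"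

definition kernel_partition_regular :: "rat mat \<Rightarrow> bool" where
  "kernel_partition_regular M \<longleftrightarrow>
    (\<forall>r \<phi>. finite_colouring r \<phi> \<longrightarrow>
      (\<exists>x \<in> carrier_vec (dim_col M). positive_vec x \<and> monochromatic \<phi> x \<and>
        M *\<^sub>v map_vec of_nat x = 0\<^sub>v (dim_row M)))"

text \<open>The tuple is \<open>(A 1, \<dots>, A k)\<close>, where every \<open>A t\<close> has \<open>u\<close> rows.\<close>

definition multiply_kernel_partition_regular :: "nat \<Rightarrow> nat \<Rightarrow> (nat \<Rightarrow> rat mat) \<Rightarrow> bool" where
  "multiply_kernel_partition_regular u k A \<longleftrightarrow>
    (\<forall>r \<phi>. finite_colouring r \<phi> \<longrightarrow>
      (\<exists>x :: nat \<Rightarrow> nat vec.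
        (\<forall>t\<in>{1..k}. x t \<in> carrier_vec (dim_col (A t)) \<and> positive_vec (x t) \<and>
          monochromatic \<phi> (x t)) \<and>
        finsum_vec TYPE(rat) u (\<lambda>t. A t *\<^sub>v map_vec of_nat (x t)) {1..k} = 0\<^sub>v u))"

text \<open>The block matrix obtained by writing matrices with \<open>u\<close> rows side by side.\<close>

definition block_row :: "nat \<Rightarrow> 'a mat list \<Rightarrow> 'a mat" where
  "block_row u Ms = mat_of_cols u (concat (map cols Ms))"

end

(* A multiply regular tuple is tested only against the colourings that record ln x modulo n on the
   scale 1/n. In a solution with constant colours on blocks, two entries of one block then have a
   ratio that is nearly an integer power of e^n. As n grows along a subsequence, comparing entries
   by order of magnitude splits the columns into ranked classes, and dividing by the largest scale
   shows that the columns of each class, weighted by limiting ratios that depend only on the block,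
   sum to a combination of the columns of higher classes. These weights and coefficients satisfy a
   homogeneous rational linear system, so they may be taken rational with the weights still
   positive. The weighted matrix then satisfies Rado's columns condition, and Deuber's theorem
   (an iteration of van der Waerden's theorem) provides its monochromatic kernel vectors.
   Conversely, given a colouring of the positive integers, one applies the regularity of the block
   matrix to the product of the colourings n -> phi(e_t n), where e_t is c_t times a common
   denominator. *)

theory Submission
  imports Defs "HOL-Library.Infinite_Set" "HOL-Library.FuncSet" "HOL-Library.Extended_Real"
begin

subsection \<open>Van der Waerden's theorem and Deuber's theorem\<close>

text \<open>The colours of different blocks are unrelated, so blocks can only be compared through
  the sizes of their entries, and within a block a colour reveals a logarithm only modulo a period.
  The period has to grow: with a fixed one, two entries of a block could have a limiting ratio other
  than 1, and their columns would need different weights. When the period tends to infinity, a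
  convergent difference of logarithms within a block must tend to 0, and more generally limits
  modulo the period are unique and additive. Hence one phase can be assigned to each column, equal
  throughout a block even if the columns of that block fall into several magnitude classes; the
  weights are the exponentials of these phases. Higher classes are the obstacle in passing to the
  limit, since their terms are unbounded on the scale of a lower class and no coefficients for them
  are given in advance. They are removed by duality: only functionals that vanish on their columns
  are applied.\<close>

definition van_der_waerden_bound :: "nat \<Rightarrow> nat \<Rightarrow> nat \<Rightarrow> bool" where
  "van_der_waerden_bound l r N \<longleftrightarrow>
    (\<forall>\<phi> :: nat \<Rightarrow> nat. (\<forall>n. \<phi> n < r) \<longrightarrow>
      (\<exists>a d. 0 < d \<and> a + Suc l * d < N \<and> (\<forall>i<l. \<phi> (a + i * d) = \<phi> a)))"

text \<open>The Graham--Rothschild form of colour focusing: with \<open>b\<^sub>s = a + l * e s\<close>, the \<open>l\<close> steps from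
  \<open>b\<^sub>s\<close> to \<open>b\<^sub>t\<close> stay in the colour of \<open>b\<^sub>s\<close> up to the last one. Two equally coloured points among
  \<open>b\<^sub>0, \<dots>, b\<^sub>r\<close> therefore yield a progression of length \<open>l + 1\<close>.\<close>

definition focused_bound :: "nat \<Rightarrow> nat \<Rightarrow> nat \<Rightarrow> nat \<Rightarrow> bool" where
  "focused_bound l r m N \<longleftrightarrow>
    (\<forall>\<phi> :: nat \<Rightarrow> nat. (\<forall>n. \<phi> n < r) \<longrightarrow>
      (\<exists>a e. e 0 = 0 \<and> (\<forall>s<m. e s < e (Suc s)) \<and> a + Suc l * e m < N \<and>
        (\<forall>t\<le>m. \<forall>s<t. \<forall>i<l. \<phi> (a + l * e s + i * (e t - e s)) = \<phi> (a + l * e s))))"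

lemma step_mono_le:
  fixes e :: "nat \<Rightarrow> nat"
  assumes "\<forall>s<m. e s < e (Suc s)" "s \<le> t" "t \<le> m"
  shows "e s \<le> e t"
  using assms(2,3)
proof (induction rule: dec_induct)
  case (step n)
  then have "e n < e (Suc n)" using assms(1) by simp
  with step show ?case by simp
qed simp

lemma step_mono_less:
  fixes e :: "nat \<Rightarrow> nat"
  assumes "\<forall>s<m. e s < e (Suc s)" "s < t" "t \<le> m"
  shows "e s < e t"
proof -
  have "e s < e (Suc s)" using assms by auto
  also have "\<dots> \<le> e t" using step_mono_le[OF assms(1), of "Suc s" t] assms by auto
  finally show ?thesis .
qed

text \<open>Words of \<open>M\<close> consecutive colours are treated as single colours. Van der
  Waerden's theorem gives \<open>l\<close> identically coloured blocks at distance \<open>D\<close>,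
  and the old points are chosen inside the initial block. Adding \<open>D\<close> to the last
  parameter \<open>e m\<close> gives the new one: a step towards the new point is a step towards the
  old last point followed by a jump to an identical block, so it keeps the colour.\<close>

lemma focused_bound_Suc:
  assumes vdw: "\<And>r. \<exists>N. van_der_waerden_bound l r N" and "focused_bound l r m M"
  shows "\<exists>N. focused_bound l r (Suc m) N"
proof -
  define B where "B = {xs. set xs \<subseteq> {..<r} \<and> length xs = M}"
  have "finite B" unfolding B_def by (rule finite_lists_length_eq) simp
  then obtain h R where h: "h ` B = {i::nat. i < R}" "inj_on h B"
    using finite_imp_inj_to_nat_seg by blast
  obtain W where W: "van_der_waerden_bound l R W" using vdw by blast
  have "focused_bound l r (Suc m) (W + M)"
    unfolding focused_bound_def
  proof (intro allI impI)
    fix \<phi> :: "nat \<Rightarrow> nat"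
    assume \<phi>: "\<forall>n. \<phi> n < r"
    define blk where "blk n = map (\<lambda>j. \<phi> (n + j)) [0..<M]" for n
    have blk: "blk n \<in> B" for n using \<phi> by (auto simp: blk_def B_def)
    have "\<forall>n. h (blk n) < R" using h(1) blk by auto
    with W obtain A D where AD: "0 < D" "A + Suc l * D < W" "\<forall>i<l. h (blk (A + i * D)) = h (blk A)"
      unfolding van_der_waerden_bound_def by (elim allE[of _ "\<lambda>n. h (blk n)"]) blast
    have "blk (A + i * D) = blk A" if "i < l" for i
      using AD(3) that h(2) blk by (meson inj_onD)
    then have shift: "\<phi> (A + i * D + j) = \<phi> (A + j)" if "i < l" "j < M" for i j
      using that by (auto simp: blk_def)
    have "\<forall>n. \<phi> (A + n) < r" using \<phi> by simp
    with assms(2) obtain a e where e: "e 0 = 0" "\<forall>s<m. e s < e (Suc s)" "a + Suc l * e m < M"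
      and foc: "\<forall>t\<le>m. \<forall>s<t. \<forall>i<l. \<phi> (A + (a + l * e s + i * (e t - e s))) = \<phi> (A + (a + l * e s))"
      unfolding focused_bound_def by (elim allE[of _ "\<lambda>n. \<phi> (A + n)"]) blast
    define e' where "e' s = (if s \<le> m then e s else e m + D)" for s
    have "\<phi> (A + a + l * e' s + i * (e' t - e' s)) = \<phi> (A + a + l * e' s)"
      if "t \<le> Suc m" "s < t" "i < l" for s t i
    proof (cases "t \<le> m")
      case True
      then show ?thesis using foc that by (simp add: e'_def add.assoc)
    next
      case False
      then have t: "t = Suc m" using that by simp
      have sm: "s \<le> m" using t that by simp
      have le: "e s \<le> e m" using step_mono_le[OF e(2) sm] by simp
      \<comment> \<open>The point reached inside the block is at most \<open>a + l * e m\<close>, so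
        it lies in the range \<open>M\<close> on which the shifted blocks agree.\<close>
      have "l * e s + i * (e m - e s) \<le> l * e s + l * (e m - e s)" using that by simp
      also have "\<dots> = l * e m" using le by (simp flip: distrib_left)
      finally have lt: "a + l * e s + i * (e m - e s) < M" using e(3) by simp
      have "i * (e' t - e' s) = i * (e m - e s) + i * D"
        using t sm le by (simp add: e'_def flip: distrib_left)
      then have "\<phi> (A + a + l * e' s + i * (e' t - e' s))
          = \<phi> (A + i * D + (a + l * e s + i * (e m - e s)))"
        using sm by (simp add: e'_def algebra_simps)
      also have "\<dots> = \<phi> (A + (a + l * e s + i * (e m - e s)))"
        using shift[OF that(3) lt] .
      also have "\<dots> = \<phi> (A + (a + l * e s))"
        using foc that sm by (cases "s = m") auto
      finally show ?thesis using sm by (simp add: e'_def add.assoc)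
    qed
    \<comment> \<open>Moving the last parameter by \<open>D\<close> costs \<open>Suc l * D\<close>;
      this is why \<open>van_der_waerden_bound\<close> reserves room beyond the end of its
      progression.\<close>
    moreover have "A + a + Suc l * e' (Suc m) < W + M"
      using AD(2) e(3) by (simp add: e'_def distrib_left)
    moreover have "\<forall>s<Suc m. e' s < e' (Suc s)"
      using e(2) AD(1) by (auto simp: e'_def less_Suc_eq)
    ultimately show "\<exists>a e. e 0 = 0 \<and> (\<forall>s<Suc m. e s < e (Suc s)) \<and> a + Suc l * e (Suc m) < W + M \<and>
        (\<forall>t\<le>Suc m. \<forall>s<t. \<forall>i<l. \<phi> (a + l * e s + i * (e t - e s)) = \<phi> (a + l * e s))"
      using e(1) by (intro exI[of _ "A + a"] exI[of _ e']) (auto simp: e'_def)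
  qed
  then show ?thesis ..
qed

text \<open>Two of the \<open>r + 1\<close> points \<open>a + l * e s\<close> share a colour, and
  the later one is the missing last term of the progression that starts at the earlier one. Doubling
  \<open>N\<close> makes room for the further steps that the bound reserves.\<close>

lemma van_der_waerden_bound_Suc:
  assumes "focused_bound l r r N"
  shows "van_der_waerden_bound (Suc l) r (2 * N)"
  unfolding van_der_waerden_bound_def
proof (intro allI impI)
  fix \<phi> :: "nat \<Rightarrow> nat"
  assume \<phi>: "\<forall>n. \<phi> n < r"
  obtain a e where e: "e 0 = 0" "\<forall>s<r. e s < e (Suc s)" "a + Suc l * e r < N"
    and foc: "\<forall>t\<le>r. \<forall>s<t. \<forall>i<l. \<phi> (a + l * e s + i * (e t - e s)) = \<phi> (a + l * e s)"
    using assms[unfolded focused_bound_def, THEN spec, THEN mp, OF \<phi>] by blast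
  have "\<not> inj_on (\<lambda>s. \<phi> (a + l * e s)) {..r}"
  proof (rule pigeonhole)
    have "(\<lambda>s. \<phi> (a + l * e s)) ` {..r} \<subseteq> {..<r}" using \<phi> by auto
    then have "card ((\<lambda>s. \<phi> (a + l * e s)) ` {..r}) \<le> r"
      using card_mono[of "{..<r}"] by fastforce
    then show "card ((\<lambda>s. \<phi> (a + l * e s)) ` {..r}) < card {..r}" by simp
  qed
  then obtain s0 t0 where "s0 \<le> r" "t0 \<le> r" "s0 \<noteq> t0" "\<phi> (a + l * e s0) = \<phi> (a + l * e t0)"
    unfolding inj_on_def by blast
  then obtain s t where st: "t \<le> r" "s < t" "\<phi> (a + l * e s) = \<phi> (a + l * e t)"
    by (metis linorder_less_linear)
  define d where "d = e t - e s"
  have lt: "e s < e t" using step_mono_less[OF e(2) st(2,1)] .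
  have end_pt: "a + l * e s + l * d = a + l * e t"
    using lt by (simp add: d_def flip: distrib_left)
  have le: "e t \<le> e r" using step_mono_le[OF e(2) st(1)] by simp
  have "a + l * e t + e t \<le> a + Suc l * e r" using mult_le_mono2[OF le, of "Suc l"] by simp
  then have bound: "a + l * e s + Suc (Suc l) * d < 2 * N"
    using e(3) end_pt lt by (simp add: d_def)
  have prog: "\<phi> (a + l * e s + i * d) = \<phi> (a + l * e s)" if "i < Suc l" for i
  proof (cases "i = l")
    case True
    then show ?thesis using st(3) by (simp only: end_pt)
  next
    case False
    then show ?thesis using foc st that by (simp add: d_def)
  qed
  show "\<exists>a d. 0 < d \<and> a + Suc (Suc l) * d < 2 * N \<and> (\<forall>i<Suc l. \<phi> (a + i * d) = \<phi> a)"
    using lt bound prog by (intro exI[of _ "a + l * e s"] exI[of _ d]) (auto simp: d_def)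
qed

lemma focused_bound_exists:
  assumes "\<And>r. \<exists>N. van_der_waerden_bound l r N"
  shows "\<exists>N. focused_bound l r m N"
proof (induction m)
  case 0
  have "focused_bound l r 0 1"
    unfolding focused_bound_def by (intro allI impI exI[of _ 0] exI[of _ "\<lambda>_. 0"]) auto
  then show ?case ..
next
  case (Suc m)
  then show ?case using focused_bound_Suc[OF assms] by blast
qed

text \<open>The number of colours is generalised in the induction because the step passes from
  colours to words of colours.\<close>

theorem van_der_waerden: "\<exists>N. van_der_waerden_bound l r N"
proof (induction l arbitrary: r)
  case 0
  have "van_der_waerden_bound 0 r 2"
    unfolding van_der_waerden_bound_def by (intro allI impI exI[of _ 0] exI[of _ 1]) auto
  then show ?case ..
next
  case (Suc l)
  then show ?case using focused_bound_exists van_der_waerden_bound_Suc by blast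
qed

text \<open>The rows of a Deuber \<open>(m, p, c)\<close>-set, listed so that the dominating generator has the largest
  index. The colour may still depend on the row; the pigeonhole principle removes this dependence in
  theorem \<open>deuber\<close>.\<close>

definition deuber_bound :: "nat \<Rightarrow> nat \<Rightarrow> nat \<Rightarrow> nat \<Rightarrow> nat \<Rightarrow> bool" where
  "deuber_bound c p r m N \<longleftrightarrow>
    (\<forall>\<phi> :: nat \<Rightarrow> nat. (\<forall>n. \<phi> n < r) \<longrightarrow>
      (\<exists>y \<kappa>. \<forall>i<m. y i \<le> N \<and>
        (\<forall>\<mu> :: nat \<Rightarrow> int. (\<forall>j<i. \<bar>\<mu> j\<bar> \<le> int p) \<longrightarrow>
          0 < int c * int (y i) + (\<Sum>j<i. \<mu> j * int (y j)) \<and>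
          \<phi> (nat (int c * int (y i) + (\<Sum>j<i. \<mu> j * int (y j)))) = \<kappa> i)))"

text \<open>The new generator sits in the middle of a long monochromatic progression, and the older
  generators are scaled by its difference, so that their combinations only move along it. The length
  of the progression must be fixed before its difference \<open>d\<close> is known, while the
  colouring used for the older generators depends on \<open>d\<close>. The bound \<open>N\<close>,
  uniform over all colourings, resolves this circle.\<close>

lemma deuber_bound_exists:
  assumes "0 < c"
  shows "\<exists>N. deuber_bound c p r m N"
proof (induction m)
  case 0
  show ?case by (auto simp: deuber_bound_def)
next
  case (Suc m)
  then obtain N where N: "deuber_bound c p r m N" ..
  \<comment> \<open>\<open>L\<close> bounds the absolute value of every admissible combination of
    the older generators, so \<open>2 * L + 1\<close> terms around the centre cover all of
    them.\<close>
  define L where "L = m * (p * N)"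
  obtain W where W: "van_der_waerden_bound (2 * L + 1) r W" using van_der_waerden by blast
  have "deuber_bound c p r (Suc m) (W + c * W * N)"
    unfolding deuber_bound_def
  proof (intro allI impI)
    fix \<phi> :: "nat \<Rightarrow> nat"
    assume \<phi>: "\<forall>n. \<phi> n < r"
    then have "\<forall>n. \<phi> (c * Suc n) < r" by simp
    with W obtain a d where ad: "0 < d" "a + Suc (2 * L + 1) * d < W"
      and prog: "\<forall>i<2 * L + 1. \<phi> (c * Suc (a + i * d)) = \<phi> (c * Suc a)"
      unfolding van_der_waerden_bound_def by (elim allE[of _ "\<lambda>n. \<phi> (c * Suc n)"]) blast
    have "\<forall>n. \<phi> (c * d * n) < r" using \<phi> by simp
    with N obtain z \<kappa> where z: "\<forall>i<m. z i \<le> N \<and>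
        (\<forall>\<mu> :: nat \<Rightarrow> int. (\<forall>j<i. \<bar>\<mu> j\<bar> \<le> int p) \<longrightarrow>
          0 < int c * int (z i) + (\<Sum>j<i. \<mu> j * int (z j)) \<and>
          \<phi> (c * d * nat (int c * int (z i) + (\<Sum>j<i. \<mu> j * int (z j)))) = \<kappa> i)"
      unfolding deuber_bound_def by (elim allE[of _ "\<lambda>n. \<phi> (c * d * n)"]) blast
    \<comment> \<open>The leading coefficient \<open>c\<close> of the new row stretches its
      progression to difference \<open>c * d\<close>, hence the factor \<open>c * d\<close> on the
      older generators. Index \<open>L\<close> is the centre, and \<open>Suc\<close> keeps the terms
      positive.\<close>
    define y where "y i = (if i < m then c * d * z i else Suc (a + L * d))" for i
    define \<kappa>' where "\<kappa>' i = (if i < m then \<kappa> i else \<phi> (c * Suc a))" for i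
    have dW: "d \<le> W" using ad(2) by simp
    have "y i \<le> W + c * W * N \<and>
        (\<forall>\<mu> :: nat \<Rightarrow> int. (\<forall>j<i. \<bar>\<mu> j\<bar> \<le> int p) \<longrightarrow>
          0 < int c * int (y i) + (\<Sum>j<i. \<mu> j * int (y j)) \<and>
          \<phi> (nat (int c * int (y i) + (\<Sum>j<i. \<mu> j * int (y j)))) = \<kappa>' i)"
      if "i < Suc m" for i
    proof (cases "i < m")
      case True
      have "c * d * z i \<le> c * W * N" using z True dW by (intro mult_le_mono) auto
      then have "y i \<le> W + c * W * N" using True unfolding y_def by (simp only: if_True trans_le_add2)
      moreover have "0 < int c * int (y i) + (\<Sum>j<i. \<mu> j * int (y j)) \<and>
          \<phi> (nat (int c * int (y i) + (\<Sum>j<i. \<mu> j * int (y j)))) = \<kappa>' i"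
        if \<mu>: "\<forall>j<i. \<bar>\<mu> j\<bar> \<le> int p" for \<mu> :: "nat \<Rightarrow> int"
      proof -
        define w where "w = int c * int (z i) + (\<Sum>j<i. \<mu> j * int (z j))"
        have w: "0 < w" "\<phi> (c * d * nat w) = \<kappa> i" using z True \<mu> by (auto simp: w_def)
        have "(\<Sum>j<i. \<mu> j * int (y j)) = int (c * d) * (\<Sum>j<i. \<mu> j * int (z j))"
          unfolding sum_distrib_left using True by (intro sum.cong) (auto simp: y_def)
        then have "int c * int (y i) + (\<Sum>j<i. \<mu> j * int (y j)) = int (c * d) * w"
          using True by (simp add: y_def w_def algebra_simps)
        moreover have "nat (int (c * d) * w) = c * d * nat w"
          using w(1) by (simp add: nat_mult_distrib)
        moreover have "0 < int (c * d) * w" using w(1) assms ad(1) by simp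
        ultimately show ?thesis using w(2) True by (simp only: \<kappa>'_def if_True simp_thms)
      qed
      ultimately show ?thesis by blast
    next
      case False
      then have i: "i = m" using that by simp
      have "0 < int c * int (y i) + (\<Sum>j<i. \<mu> j * int (y j)) \<and>
          \<phi> (nat (int c * int (y i) + (\<Sum>j<i. \<mu> j * int (y j)))) = \<kappa>' i"
        if \<mu>: "\<forall>j<i. \<bar>\<mu> j\<bar> \<le> int p" for \<mu> :: "nat \<Rightarrow> int"
      proof -
        define w where "w = (\<Sum>j<m. \<mu> j * int (z j))"
        have "\<bar>w\<bar> \<le> (\<Sum>j<m. \<bar>\<mu> j * int (z j)\<bar>)" unfolding w_def by (rule sum_abs)
        also have "\<dots> \<le> (\<Sum>j<m. int p * int N)"
          using \<mu> z i by (intro sum_mono) (auto simp: abs_mult intro!: mult_mono)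
        finally have wL: "\<bar>w\<bar> \<le> int L" by (simp add: L_def)
        define n where "n = nat (int L + w)"
        have n: "int n = int L + w" "n < 2 * L + 1" using wL by (auto simp: n_def)
        have "(\<Sum>j<m. \<mu> j * int (y j)) = int (c * d) * w"
          unfolding sum_distrib_left w_def by (intro sum.cong) (auto simp: y_def)
        then have "int c * int (y i) + (\<Sum>j<i. \<mu> j * int (y j)) = int c * (1 + int a + (int L + w) * int d)"
          by (simp add: i y_def algebra_simps)
        also have "\<dots> = int (c * Suc (a + n * d))" by (simp add: n(1)[symmetric] distrib_left)
        finally have v: "int c * int (y i) + (\<Sum>j<i. \<mu> j * int (y j)) = int (c * Suc (a + n * d))" .
        have "\<phi> (c * Suc (a + n * d)) = \<kappa>' i" using prog n(2) i by (simp add: \<kappa>'_def)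
        moreover have "0 < c * Suc (a + n * d)" using assms by simp
        ultimately show ?thesis unfolding v nat_int of_nat_0_less_iff by blast
      qed
      moreover have "y i \<le> W + c * W * N" using ad(2) i by (simp add: y_def algebra_simps)
      ultimately show ?thesis by blast
    qed
    then show "\<exists>y \<kappa>. \<forall>i<Suc m. y i \<le> W + c * W * N \<and>
        (\<forall>\<mu> :: nat \<Rightarrow> int. (\<forall>j<i. \<bar>\<mu> j\<bar> \<le> int p) \<longrightarrow>
          0 < int c * int (y i) + (\<Sum>j<i. \<mu> j * int (y j)) \<and>
          \<phi> (nat (int c * int (y i) + (\<Sum>j<i. \<mu> j * int (y j)))) = \<kappa> i)"
      by blast
  qed
  then show ?case ..
qed

theorem deuber:
  fixes \<phi> :: "nat \<Rightarrow> nat"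
  assumes "0 < c" "\<And>n. \<phi> n < r"
  shows "\<exists>y \<kappa>. \<forall>i<m. \<forall>\<mu> :: nat \<Rightarrow> int. (\<forall>j<i. \<bar>\<mu> j\<bar> \<le> int p) \<longrightarrow>
      0 < int c * int (y i) + (\<Sum>j<i. \<mu> j * int (y j)) \<and>
      \<phi> (nat (int c * int (y i) + (\<Sum>j<i. \<mu> j * int (y j)))) = \<kappa>"
proof -
  obtain N where N: "deuber_bound c p r (r * m) N" using deuber_bound_exists[OF assms(1)] by blast
  have \<phi>: "\<forall>n. \<phi> n < r" using assms(2) by simp
  obtain y \<kappa> where y: "\<And>i \<mu>. i < r * m \<Longrightarrow> \<forall>j<i. \<bar>\<mu> j\<bar> \<le> int p \<Longrightarrow>
          0 < int c * int (y i) + (\<Sum>j<i. \<mu> j * int (y j)) \<and>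
          \<phi> (nat (int c * int (y i) + (\<Sum>j<i. \<mu> j * int (y j)))) = \<kappa> i"
    using N[unfolded deuber_bound_def, THEN spec, THEN mp, OF \<phi>] by blast
  have r: "0 < r" using assms(2)[of 0] by simp
  have "\<kappa> i < r" if "i < r * m" for i
    using y[OF that, of "\<lambda>_. 0"] assms(2) by (metis abs_zero of_nat_0_le_iff)
  then have "\<kappa> \<in> {..<r * m} \<rightarrow> {..<r}" by auto
  then obtain b where "card {..<r * m} \<le> card (\<kappa> -` {b} \<inter> {..<r * m}) * card {..<r}"
    using pigeonhole_card[of \<kappa> "{..<r * m}" "{..<r}"] r by auto
  then have "m \<le> card (\<kappa> -` {b} \<inter> {..<r * m})" using r by (simp add: mult.commute)
  then obtain B where B: "B \<subseteq> \<kappa> -` {b} \<inter> {..<r * m}" "card B = m" "finite B"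
    by (metis obtain_subset_with_card_n)
  obtain e where e: "bij_betw e {..<m} B" "strict_mono_on {..<m} e"
    using ex_bij_betw_strict_mono_card[OF B(3)] B(2) by blast
  have eB: "\<kappa> (e i) = b" "e i < r * m" if "i < m" for i
    using e(1) B(1) that by (auto simp: bij_betw_def)
  have inj: "inj_on e {..<m}" using e(1) by (simp add: bij_betw_def)
  have "0 < int c * int (y (e i)) + (\<Sum>j<i. \<mu> j * int (y (e j))) \<and>
      \<phi> (nat (int c * int (y (e i)) + (\<Sum>j<i. \<mu> j * int (y (e j))))) = b"
    if i: "i < m" and \<mu>: "\<forall>j<i. \<bar>\<mu> j\<bar> \<le> int p" for i and \<mu> :: "nat \<Rightarrow> int"
  proof -
    \<comment> \<open>Generators outside the selected rows receive coefficient 0. Since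
      \<open>e\<close> is increasing, combinations of earlier selected generators are again
      combinations of earlier generators.\<close>
    define \<nu> where "\<nu> j = (if j \<in> e ` {..<i} then \<mu> (inv_into {..<m} e j) else 0)" for j
    have \<nu>e: "\<nu> (e j) = \<mu> j" if "j < i" for j
      using that i inj by (auto simp: \<nu>_def)
    have "\<forall>j<e i. \<bar>\<nu> j\<bar> \<le> int p"
      using \<nu>e \<mu> by (auto simp: \<nu>_def)
    moreover have "(\<Sum>j<e i. \<nu> j * int (y j)) = (\<Sum>j<i. \<mu> j * int (y (e j)))"
    proof -
      have "e ` {..<i} \<subseteq> {..<e i}"
        using e(2) i by (auto simp: strict_mono_on_def)
      then have "(\<Sum>j<e i. \<nu> j * int (y j)) = (\<Sum>j\<in>e ` {..<i}. \<nu> j * int (y j))"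
        by (intro sum.mono_neutral_right) (auto simp: \<nu>_def)
      also have "\<dots> = (\<Sum>j<i. \<nu> (e j) * int (y (e j)))"
        using inj_on_subset[OF inj] i by (subst sum.reindex) (auto simp: o_def)
      finally show ?thesis using \<nu>e by simp
    qed
    ultimately show ?thesis using y[OF eB(2)[OF i], of \<nu>] eB(1)[OF i] by simp
  qed
  then show ?thesis by (intro exI[of _ "\<lambda>i. y (e i)"] exI[of _ b]) blast
qed

subsection \<open>Rado's columns condition implies regularity\<close>

text \<open>One notion covers both sides of the equivalence: columns are indexed by
  \<open>J\<close>, and only entries with equal tags \<open>\<tau>\<close> must agree in colour. A
  constant tag describes a single matrix, the block number as tag describes a tuple.\<close>

definition regular_system :: "nat \<Rightarrow> 'i set \<Rightarrow> ('i \<Rightarrow> 't) \<Rightarrow> ('i \<Rightarrow> nat \<Rightarrow> rat) \<Rightarrow> bool" where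
  "regular_system u J \<tau> a \<longleftrightarrow>
    (\<forall>r \<phi>. finite_colouring r \<phi> \<longrightarrow>
      (\<exists>x. (\<forall>i\<in>J. 0 < x i) \<and> (\<forall>i\<in>J. \<forall>j\<in>J. \<tau> i = \<tau> j \<longrightarrow> \<phi> (x i) = \<phi> (x j)) \<and>
        (\<forall>w<u. (\<Sum>i\<in>J. a i w * of_nat (x i)) = 0)))"

text \<open>Lets tuples of colours and integer residues serve as colours: a finite range is
  renumbered injectively.\<close>

lemma regular_system_finite_range:
  fixes f :: "nat \<Rightarrow> 'c"
  assumes "regular_system u J \<tau> a" and "finite (f ` {1..})"
  shows "\<exists>x. (\<forall>i\<in>J. 0 < x i) \<and> (\<forall>i\<in>J. \<forall>j\<in>J. \<tau> i = \<tau> j \<longrightarrow> f (x i) = f (x j)) \<and>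
    (\<forall>w<u. (\<Sum>i\<in>J. a i w * of_nat (x i)) = 0)"
proof -
  obtain h R where h: "h ` (f ` {1..}) = {i::nat. i < R}" "inj_on h (f ` {1..})"
    using finite_imp_inj_to_nat_seg[OF assms(2)] by blast
  have lt: "h (f n) < R" if "0 < n" for n using h(1) that by (auto simp: Suc_le_eq image_subset_iff)
  have "finite_colouring R (\<lambda>n. Suc (h (f n)))"
    using lt lt[of 1] by (auto simp: finite_colouring_def Suc_le_eq intro: le_less_trans)
  then obtain x where x: "\<forall>i\<in>J. 0 < x i"
      "\<forall>i\<in>J. \<forall>j\<in>J. \<tau> i = \<tau> j \<longrightarrow> Suc (h (f (x i))) = Suc (h (f (x j)))"
      "\<forall>w<u. (\<Sum>i\<in>J. a i w * of_nat (x i)) = 0"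
    using assms(1)[unfolded regular_system_def, THEN spec, THEN spec, THEN mp] by blast
  have "f (x i) = f (x j)" if "i \<in> J" "j \<in> J" "\<tau> i = \<tau> j" for i j
  proof (rule inj_onD[OF h(2)])
    show "h (f (x i)) = h (f (x j))" using x(2) that by blast
    show "f (x i) \<in> f ` {1..}" "f (x j) \<in> f ` {1..}"
      using x(1) that by (simp_all add: Suc_le_eq)
  qed
  then show ?thesis using x(1,3) by blast
qed

lemma common_denominator:
  fixes S :: "rat set"
  assumes "finite S"
  shows "\<exists>c::nat. 0 < c \<and> (\<forall>x\<in>S. of_nat c * x \<in> \<int>)"
  using assms
proof (induction S)
  case empty
  show ?case by (intro exI[of _ 1]) simp
next
  case (insert x S)
  then obtain c :: nat where c: "0 < c" "\<forall>x\<in>S. of_nat c * x \<in> \<int>" by blast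
  obtain p q where "quotient_of x = (p, q)" by force
  then have pq: "x = of_int p / of_int q" "0 < q"
    by (rule quotient_of_div, rule quotient_of_denom_pos)
  have "of_nat (c * nat q) * x \<in> \<int>" using pq by (simp add: of_nat_nat)
  moreover have "of_nat (c * nat q) * y \<in> \<int>" if "y \<in> S" for y
  proof -
    have "of_nat (c * nat q) * y = of_int q * (of_nat c * y)" using pq(2) by simp
    then show ?thesis using c(2) that by (simp only: Ints_mult Ints_of_int)
  qed
  ultimately show ?case using c(1) pq(2) by (intro exI[of _ "c * nat q"]) auto
qed

text \<open>A larger \<open>\<rho>\<close> corresponds to a more dominant row of Deuber's system.
  The entry at column \<open>i\<close> is \<open>c\<close> times the generator
  \<open>y (\<rho> i)\<close> minus \<open>c * q s i\<close> times each lower generator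
  \<open>y s\<close>. In the equation, \<open>c * y s\<close> is then multiplied by the sum of class
  \<open>s\<close> minus its prescribed combination of higher columns, which is 0.\<close>

lemma columns_condition_imp_regular_system:
  fixes a :: "'i \<Rightarrow> nat \<Rightarrow> rat" and q :: "nat \<Rightarrow> 'i \<Rightarrow> rat" and \<rho> :: "'i \<Rightarrow> nat"
  assumes fin: "finite J"
    and cc: "\<And>s w. w < u \<Longrightarrow> (\<Sum>i | i \<in> J \<and> \<rho> i = s. a i w) = (\<Sum>i | i \<in> J \<and> s < \<rho> i. q s i * a i w)"
  shows "regular_system u J (\<lambda>_. ()) a"
  unfolding regular_system_def
proof (intro allI impI)
  fix r \<phi>
  assume \<phi>: "finite_colouring r \<phi>"
  define m where "m = Suc (Max (insert 0 (\<rho> ` J)))"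
  have m: "\<rho> i < m" if "i \<in> J" for i
    using fin that unfolding m_def by (simp add: less_Suc_eq_le)
  obtain c :: nat where c: "0 < c" "\<forall>x \<in> (\<lambda>(s, i). q s i) ` ({..<m} \<times> J). of_nat c * x \<in> \<int>"
    using common_denominator[of "(\<lambda>(s, i). q s i) ` ({..<m} \<times> J)"] fin by auto
  define z where "z i s = \<lfloor>of_nat c * q s i\<rfloor>" for i s
  have z: "of_int (z i s) = of_nat c * q s i" if "s < m" "i \<in> J" for i s
    using c(2) that unfolding z_def by (auto elim!: Ints_cases)
  define p where "p = Max (insert 0 ((\<lambda>(s, i). nat \<bar>z i s\<bar>) ` ({..<m} \<times> J)))"
  have p: "\<bar>z i s\<bar> \<le> int p" if "s < m" "i \<in> J" for i s
  proof -
    have "nat \<bar>z i s\<bar> \<le> p" using that fin unfolding p_def by (intro Max_ge) auto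
    then show ?thesis by linarith
  qed
  \<comment> \<open>A finite colouring is unrestricted at 0, whereas \<open>deuber\<close> wants a
    bound everywhere; 0 therefore gets the extra colour 0.\<close>
  define \<psi> where "\<psi> n = (if n = 0 then 0 else \<phi> n)" for n
  have "\<psi> n < Suc r" for n
    using \<phi> by (auto simp: \<psi>_def finite_colouring_def Pi_iff Suc_le_eq less_Suc_eq_le)
  then obtain y \<kappa> where y: "\<And>i \<mu>. i < m \<Longrightarrow> \<forall>j<i. \<bar>\<mu> j\<bar> \<le> int p \<Longrightarrow>
      0 < int c * int (y i) + (\<Sum>j<i. \<mu> j * int (y j)) \<and>
      \<psi> (nat (int c * int (y i) + (\<Sum>j<i. \<mu> j * int (y j)))) = \<kappa>"
    using deuber[OF c(1), of \<psi> "Suc r" m p] by blast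
  define X where "X i = int c * int (y (\<rho> i)) + (\<Sum>j<\<rho> i. - z i j * int (y j))" for i
  have X: "0 < X i" "\<psi> (nat (X i)) = \<kappa>" if "i \<in> J" for i
  proof -
    have "\<forall>j<\<rho> i. \<bar>- z i j\<bar> \<le> int p" using p[of _ i] m[OF that] that by auto
    then show "0 < X i" "\<psi> (nat (X i)) = \<kappa>"
      using y[OF m[OF that], of "\<lambda>j. - z i j"] by (auto simp: X_def)
  qed
  have "(\<Sum>i\<in>J. a i w * of_nat (nat (X i))) = 0" if w: "w < u" for w
  proof -
    define Y :: "nat \<Rightarrow> rat" where "Y s = of_nat c * of_nat (y s)" for s
    have eq: "of_nat (nat (X i)) = Y (\<rho> i) - (\<Sum>s<m. if s < \<rho> i then q s i * Y s else 0)"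
      if i: "i \<in> J" for i
    proof -
      have "of_nat (nat (X i)) = (of_int (X i) :: rat)" using X(1)[OF i] by simp
      also have "\<dots> = Y (\<rho> i) - (\<Sum>s<\<rho> i. of_int (z i s) * of_nat (y s))"
        by (simp add: X_def Y_def sum_negf)
      also have "(\<Sum>s<\<rho> i. of_int (z i s) * of_nat (y s)) = (\<Sum>s<\<rho> i. q s i * Y s)"
        using z[OF _ i] m[OF i] by (intro sum.cong) (auto simp: Y_def)
      also have "\<dots> = (\<Sum>s<m. if s < \<rho> i then q s i * Y s else 0)"
        using m[OF i] by (intro sum.mono_neutral_cong_left) auto
      finally show ?thesis .
    qed
    have "(\<Sum>i\<in>J. a i w * Y (\<rho> i)) = (\<Sum>s<m. \<Sum>i | i \<in> J \<and> \<rho> i = s. a i w * Y (\<rho> i))"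
      using m fin by (intro sum.group[symmetric]) auto
    also have "\<dots> = (\<Sum>s<m. Y s * (\<Sum>i | i \<in> J \<and> \<rho> i = s. a i w))"
      by (simp add: sum_distrib_left mult.commute)
    also have "\<dots> = (\<Sum>s<m. Y s * (\<Sum>i | i \<in> J \<and> s < \<rho> i. q s i * a i w))"
      by (simp add: cc[OF w])
    also have "\<dots> = (\<Sum>s<m. \<Sum>i\<in>J. a i w * (if s < \<rho> i then q s i * Y s else 0))"
      unfolding sum_distrib_left
      using fin by (intro sum.cong sum.mono_neutral_cong_left) auto
    also have "\<dots> = (\<Sum>i\<in>J. a i w * (\<Sum>s<m. if s < \<rho> i then q s i * Y s else 0))"
      unfolding sum_distrib_left by (rule sum.swap)
    finally show ?thesis by (simp add: eq right_diff_distrib sum_subtractf)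
  qed
  moreover have "\<phi> (nat (X i)) = \<kappa>" if "i \<in> J" for i using X[OF that] by (simp add: \<psi>_def)
  ultimately show "\<exists>x. (\<forall>i\<in>J. 0 < x i) \<and> (\<forall>i\<in>J. \<forall>j\<in>J. () = () \<longrightarrow> \<phi> (x i) = \<phi> (x j)) \<and>
        (\<forall>w<u. (\<Sum>i\<in>J. a i w * of_nat (x i)) = 0)"
    using X(1) by (intro exI[of _ "\<lambda>i. nat (X i)"]) auto
qed

lemma regular_system_rescale:
  fixes d :: "'t \<Rightarrow> rat"
  assumes fin: "finite J" and d: "\<And>i. i \<in> J \<Longrightarrow> 0 < d (\<tau> i)"
    and reg: "regular_system u J (\<lambda>_. ()) (\<lambda>i w. d (\<tau> i) * a i w)"
  shows "regular_system u J \<tau> a"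
  unfolding regular_system_def
proof (intro allI impI)
  fix r \<phi>
  assume \<phi>: "finite_colouring r \<phi>"
  obtain c :: nat where c: "0 < c" "\<forall>x \<in> d ` \<tau> ` J. of_nat c * x \<in> \<int>"
    using common_denominator[of "d ` \<tau> ` J"] fin by auto
  define e where "e t = nat \<lfloor>of_nat c * d t\<rfloor>" for t
  have e: "of_nat (e (\<tau> i)) = of_nat c * d (\<tau> i)" "0 < e (\<tau> i)" if "i \<in> J" for i
  proof -
    have "of_nat c * d (\<tau> i) \<in> \<int>" using c(2) that by auto
    then obtain k where k: "of_nat c * d (\<tau> i) = of_int k" by (rule Ints_cases)
    moreover have "0 < of_nat c * d (\<tau> i)" using c(1) d[OF that] by simp
    ultimately have "0 < k" by simp
    then show "of_nat (e (\<tau> i)) = of_nat c * d (\<tau> i)" "0 < e (\<tau> i)" using k by (auto simp: e_def)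
  qed
  \<comment> \<open>Fixing the value 0 off the finite set of occurring tags leaves only finitely
    many functions, even if the type of tags is infinite.\<close>
  define f where "f n = (\<lambda>t. if t \<in> \<tau> ` J then \<phi> (e t * n) else 0)" for n
  have "finite {f. \<forall>x. (x \<in> \<tau> ` J \<longrightarrow> f x \<in> {1..r}) \<and> (x \<notin> \<tau> ` J \<longrightarrow> f x = 0)}"
    using fin by (intro finite_set_of_finite_funs) auto
  moreover have "f ` {1..} \<subseteq> {f. \<forall>x. (x \<in> \<tau> ` J \<longrightarrow> f x \<in> {1..r}) \<and> (x \<notin> \<tau> ` J \<longrightarrow> f x = 0)}"
    using \<phi> e(2) by (auto simp: f_def finite_colouring_def Pi_iff Suc_le_eq)
  ultimately have "finite (f ` {1..})" by (rule finite_subset[rotated])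
  from regular_system_finite_range[OF reg this] obtain x where x: "\<forall>i\<in>J. 0 < x i"
      "\<forall>i\<in>J. \<forall>j\<in>J. f (x i) = f (x j)" "\<forall>w<u. (\<Sum>i\<in>J. d (\<tau> i) * a i w * of_nat (x i)) = 0"
    by auto
  have col: "\<phi> (e (\<tau> i) * x i) = \<phi> (e (\<tau> j) * x j)" if "i \<in> J" "j \<in> J" "\<tau> i = \<tau> j" for i j
  proof -
    have "f (x i) = f (x j)" using x(2) that by blast
    then have "f (x i) (\<tau> i) = f (x j) (\<tau> i)" by simp
    then show ?thesis using that by (auto simp: f_def)
  qed
  have sol: "(\<Sum>i\<in>J. a i w * of_nat (e (\<tau> i) * x i)) = 0" if "w < u" for w
  proof -
    have "(\<Sum>i\<in>J. a i w * of_nat (e (\<tau> i) * x i)) = of_nat c * (\<Sum>i\<in>J. d (\<tau> i) * a i w * of_nat (x i))"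
      unfolding sum_distrib_left by (intro sum.cong) (auto simp: e(1))
    then show ?thesis using x(3) that by simp
  qed
  have pos: "0 < e (\<tau> i) * x i" if "i \<in> J" for i using x(1) e(2) that by simp
  show "\<exists>x. (\<forall>i\<in>J. 0 < x i) \<and> (\<forall>i\<in>J. \<forall>j\<in>J. \<tau> i = \<tau> j \<longrightarrow> \<phi> (x i) = \<phi> (x j)) \<and>
        (\<forall>w<u. (\<Sum>i\<in>J. a i w * of_nat (x i)) = 0)"
    by (intro exI[of _ "\<lambda>i. e (\<tau> i) * x i"] conjI ballI allI impI col sol pos)
qed

subsection \<open>Linear systems and subsequences\<close>

text \<open>Induction on the spanning family. A functional \<open>g\<close> that kills the old
  vectors but not the new \<open>b j\<close> is used twice: to subtract a multiple of
  \<open>b j\<close> from \<open>v\<close>, and to correct a functional separating the remainder so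
  that it kills \<open>b j\<close> as well.\<close>

lemma fredholm_alternative:
  fixes b :: "'i \<Rightarrow> nat \<Rightarrow> 'a::field"
  assumes "finite S"
  shows "(\<exists>q. \<forall>w<u. v w = (\<Sum>i\<in>S. q i * b i w)) \<or>
    (\<exists>f. (\<forall>i\<in>S. (\<Sum>w<u. f w * b i w) = 0) \<and> (\<Sum>w<u. f w * v w) \<noteq> 0)"
  using assms
proof (induction S arbitrary: v)
  case empty
  show ?case
  proof (cases "\<forall>w<u. v w = 0")
    case False
    then obtain k where k: "k < u" "v k \<noteq> 0" by blast
    have "(\<Sum>w<u. (if w = k then 1 else 0) * v w) = v k"
      using k(1) by (simp add: if_distrib[of "\<lambda>x. x * _"] cong: if_cong)
    then show ?thesis using k by (intro disjI2 exI[of _ "\<lambda>w. if w = k then 1 else 0"]) simp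
  qed simp
next
  case (insert j S)
  consider (span) p where "\<forall>w<u. b j w = (\<Sum>i\<in>S. p i * b i w)"
    | (sep) g where "\<forall>i\<in>S. (\<Sum>w<u. g w * b i w) = 0" "(\<Sum>w<u. g w * b j w) \<noteq> 0"
    using insert.IH[of "b j"] by blast
  then show ?case
  proof cases
    case span
    consider q where "\<forall>w<u. v w = (\<Sum>i\<in>S. q i * b i w)"
      | f where "\<forall>i\<in>S. (\<Sum>w<u. f w * b i w) = 0" "(\<Sum>w<u. f w * v w) \<noteq> 0"
      using insert.IH[of v] by blast
    then show ?thesis
    proof cases
      case 1
      have "(\<Sum>i\<in>insert j S. (q(j := 0)) i * b i w) = (\<Sum>i\<in>S. q i * b i w)" for w
        using insert.hyps by (auto intro!: sum.cong)
      then show ?thesis using 1 by (intro disjI1 exI[of _ "q(j := 0)"]) simp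
    next
      case 2
      have "(\<Sum>w<u. f w * b j w) = (\<Sum>w<u. \<Sum>i\<in>S. p i * (f w * b i w))"
        using span by (intro sum.cong) (auto simp: sum_distrib_left algebra_simps)
      also have "\<dots> = (\<Sum>i\<in>S. p i * (\<Sum>w<u. f w * b i w))"
        by (subst sum.swap) (simp add: sum_distrib_left)
      also have "\<dots> = 0" using 2 by simp
      finally show ?thesis using 2 by blast
    qed
  next
    case sep
    define \<mu> where "\<mu> = (\<Sum>w<u. g w * v w) / (\<Sum>w<u. g w * b j w)"
    consider q where "\<forall>w<u. v w - \<mu> * b j w = (\<Sum>i\<in>S. q i * b i w)"
      | f where "\<forall>i\<in>S. (\<Sum>w<u. f w * b i w) = 0" "(\<Sum>w<u. f w * (v w - \<mu> * b j w)) \<noteq> 0"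
      using insert.IH[of "\<lambda>w. v w - \<mu> * b j w"] by blast
    then show ?thesis
    proof cases
      case 1
      have "(\<Sum>i\<in>insert j S. (q(j := \<mu>)) i * b i w) = \<mu> * b j w + (\<Sum>i\<in>S. q i * b i w)" for w
        using insert.hyps by (auto intro!: sum.cong)
      then show ?thesis using 1 by (intro disjI1 exI[of _ "q(j := \<mu>)"]) (simp add: algebra_simps)
    next
      case 2
      define \<nu> where "\<nu> = (\<Sum>w<u. f w * b j w) / (\<Sum>w<u. g w * b j w)"
      have eq: "(\<Sum>w<u. (f w - \<nu> * g w) * h w) = (\<Sum>w<u. f w * h w) - \<nu> * (\<Sum>w<u. g w * h w)" for h
        by (simp add: left_diff_distrib sum_subtractf sum_distrib_left mult.assoc)
      \<comment> \<open>Both corrections remove the same number, since \<open>\<nu>\<close> times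
        \<open>g\<close> of \<open>v\<close> equals \<open>\<mu>\<close> times \<open>f\<close> of
        \<open>b j\<close>.\<close>
      have "(\<Sum>w<u. f w * v w) - \<nu> * (\<Sum>w<u. g w * v w) = (\<Sum>w<u. f w * v w) - \<mu> * (\<Sum>w<u. f w * b j w)"
        by (simp add: \<mu>_def \<nu>_def)
      also have "\<dots> = (\<Sum>w<u. f w * (v w - \<mu> * b j w))"
        by (simp add: right_diff_distrib sum_subtractf sum_distrib_left mult.left_commute)
      finally have "(\<Sum>w<u. (f w - \<nu> * g w) * v w) \<noteq> 0" using 2(2) eq by simp
      moreover have "\<forall>i\<in>insert j S. (\<Sum>w<u. (f w - \<nu> * g w) * b i w) = 0"
        using 2(1) sep unfolding eq by (auto simp: \<nu>_def)
      ultimately show ?thesis by (intro disjI2 exI[of _ "\<lambda>w. f w - \<nu> * g w"] conjI)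
    qed
  qed
qed

text \<open>A value that is a rational combination of the earlier ones is forced by their
  approximations, whose tolerance is tightened in advance. A value independent of them has
  coefficient 0 in every relation, so any nearby rational will do.\<close>

lemma rational_approximation_preserving_relations:
  fixes w :: "'i \<Rightarrow> real"
  assumes "finite W" "0 < \<epsilon>"
  shows "\<exists>w' :: 'i \<Rightarrow> rat. (\<forall>i\<in>W. \<bar>of_rat (w' i) - w i\<bar> < \<epsilon>) \<and>
    (\<forall>q :: 'i \<Rightarrow> rat. (\<Sum>i\<in>W. of_rat (q i) * w i) = 0 \<longrightarrow> (\<Sum>i\<in>W. q i * w' i) = 0)"
  using assms
proof (induction W arbitrary: \<epsilon>)
  case empty
  then show ?case by simp
next
  case (insert j W)
  show ?case
  proof (cases "\<exists>p :: 'i \<Rightarrow> rat. w j = (\<Sum>i\<in>W. of_rat (p i) * w i)")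
    case True
    then obtain p :: "'i \<Rightarrow> rat" where p: "w j = (\<Sum>i\<in>W. of_rat (p i) * w i)" by blast
    \<comment> \<open>Errors below \<open>\<epsilon> / K\<close> in the earlier values add up to at
      most \<open>(K - 1) * (\<epsilon> / K)\<close>; the summand 1 makes this smaller than
      \<open>\<epsilon>\<close> and keeps \<open>K\<close> positive.\<close>
    define K where "K = 1 + (\<Sum>i\<in>W. \<bar>of_rat (p i) :: real\<bar>)"
    have K: "1 \<le> K" by (simp add: K_def sum_nonneg)
    have "0 < \<epsilon> / K" using insert.prems K by simp
    then obtain w' :: "'i \<Rightarrow> rat" where near: "\<And>i. i \<in> W \<Longrightarrow> \<bar>of_rat (w' i) - w i\<bar> < \<epsilon> / K"
      and rel: "\<And>q :: 'i \<Rightarrow> rat. (\<Sum>i\<in>W. of_rat (q i) * w i) = 0 \<Longrightarrow> (\<Sum>i\<in>W. q i * w' i) = 0"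
      using insert.IH by blast
    define w'' where "w'' = w'(j := \<Sum>i\<in>W. p i * w' i)"
    have w'': "w'' i = w' i" if "i \<in> W" for i using that insert.hyps by (auto simp: w''_def)
    have "\<bar>of_rat (w'' j) - w j\<bar> = \<bar>\<Sum>i\<in>W. of_rat (p i) * (of_rat (w' i) - w i)\<bar>"
      by (simp add: w''_def p of_rat_sum of_rat_mult right_diff_distrib sum_subtractf)
    also have "\<dots> \<le> (\<Sum>i\<in>W. \<bar>of_rat (p i) * (of_rat (w' i) - w i)\<bar>)" by (rule sum_abs)
    also have "\<dots> \<le> (\<Sum>i\<in>W. \<bar>of_rat (p i)\<bar> * (\<epsilon> / K))"
      unfolding abs_mult using near by (intro sum_mono mult_left_mono) (auto intro: less_imp_le)
    also have "\<dots> = (K - 1) * (\<epsilon> / K)" by (simp only: K_def sum_distrib_right[symmetric] add_diff_cancel_left')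
    also have "\<dots> < K * (\<epsilon> / K)" using insert.prems K by (intro mult_strict_right_mono) auto
    also have "\<dots> = \<epsilon>" using K by simp
    finally have "\<bar>of_rat (w'' j) - w j\<bar> < \<epsilon>" .
    moreover have "\<epsilon> / K \<le> \<epsilon>" using insert.prems K by (simp add: field_simps)
    then have "\<bar>of_rat (w'' i) - w i\<bar> < \<epsilon>" if "i \<in> W" for i
      using near[OF that] w''[OF that] by simp
    moreover have "(\<Sum>i\<in>insert j W. q i * w'' i) = 0"
      if q: "(\<Sum>i\<in>insert j W. of_rat (q i) * w i) = 0" for q :: "'i \<Rightarrow> rat"
    proof -
      have "(\<Sum>i\<in>W. of_rat (q j * p i + q i) * w i) = (\<Sum>i\<in>insert j W. of_rat (q i) * w i)"
        using insert.hyps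
        by (simp add: of_rat_add of_rat_mult distrib_right sum.distrib p sum_distrib_left mult.assoc)
      then have "(\<Sum>i\<in>W. (q j * p i + q i) * w' i) = 0" using q by (intro rel) simp
      then show ?thesis using insert.hyps w''
        by (simp add: w''_def distrib_right sum.distrib sum_distrib_left mult.assoc cong: sum.cong)
    qed
    ultimately show ?thesis by (intro exI[of _ w'']) simp
  next
    case False
    obtain w' :: "'i \<Rightarrow> rat" where near: "\<And>i. i \<in> W \<Longrightarrow> \<bar>of_rat (w' i) - w i\<bar> < \<epsilon>"
      and rel: "\<And>q :: 'i \<Rightarrow> rat. (\<Sum>i\<in>W. of_rat (q i) * w i) = 0 \<Longrightarrow> (\<Sum>i\<in>W. q i * w' i) = 0"
      using insert.IH[OF insert.prems] by blast
    obtain t :: rat where t: "w j - \<epsilon> < of_rat t" "of_rat t < w j"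
      using of_rat_dense[of "w j - \<epsilon>" "w j"] insert.prems by auto
    define w'' where "w'' = w'(j := t)"
    have w'': "w'' i = w' i" if "i \<in> W" for i using that insert.hyps by (auto simp: w''_def)
    have "(\<Sum>i\<in>insert j W. q i * w'' i) = 0"
      if q: "(\<Sum>i\<in>insert j W. of_rat (q i) * w i) = 0" for q :: "'i \<Rightarrow> rat"
    proof -
      have q': "of_rat (q j) * w j + (\<Sum>i\<in>W. of_rat (q i) * w i) = 0" using q insert.hyps by simp
      have "q j = 0"
      proof (rule ccontr)
        assume nz: "q j \<noteq> 0"
        have "(\<Sum>i\<in>W. of_rat (- q i / q j) * w i) = - (\<Sum>i\<in>W. of_rat (q i) * w i) / of_rat (q j)"
          by (simp add: of_rat_divide of_rat_minus sum_negf sum_divide_distrib)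
        also have "\<dots> = w j" using q' nz by (simp add: field_simps)
        finally show False using False by metis
      qed
      then show ?thesis using q' rel insert.hyps w'' by (simp cong: sum.cong)
    qed
    moreover have "\<bar>of_rat (w'' i) - w i\<bar> < \<epsilon>" if "i \<in> insert j W" for i
      using that near w'' t by (cases "i = j") (auto simp: w''_def)
    ultimately show ?thesis by (intro exI[of _ w'']) blast
  qed
qed

section \<open>Common subsequences with limits in the extended reals\<close>

lemma common_subsequence_extended_limits:
  fixes g :: "'i \<Rightarrow> nat \<Rightarrow> real"
  assumes "finite I"
  shows "\<exists>r. strict_mono r \<and> (\<forall>i\<in>I. \<exists>l. (\<lambda>n. ereal (g i (r n))) \<longlonglongrightarrow> l)"
  using assms
proof (induction I)
  case empty
  show ?case by (intro exI[of _ id]) (simp add: strict_mono_def)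
next
  case (insert j I)
  then obtain r where r: "strict_mono r" "\<forall>i\<in>I. \<exists>l. (\<lambda>n. ereal (g i (r n))) \<longlonglongrightarrow> l" by blast
  obtain l r' where r': "strict_mono (r' :: nat \<Rightarrow> nat)" "((\<lambda>n. ereal (g j (r n))) \<circ> r') \<longlonglongrightarrow> l"
    using compact_complete_linorder[of "\<lambda>n. ereal (g j (r n))"] by blast
  have "\<exists>l. (\<lambda>n. ereal (g i ((r \<circ> r') n))) \<longlonglongrightarrow> l" if "i \<in> insert j I" for i
  proof (cases "i = j")
    case True
    then show ?thesis using r'(2) by (auto simp: o_def)
  next
    case False
    then have "i \<in> I" using that by simp
    from bspec[OF r(2) this] obtain l where "(\<lambda>n. ereal (g i (r n))) \<longlonglongrightarrow> l" ..
    from LIMSEQ_subseq_LIMSEQ[OF this r'(1)] show ?thesis by (auto simp: o_def)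
  qed
  then show ?case using strict_mono_o[OF r(1) r'(1)] by blast
qed

lemma common_subsequence_limits:
  fixes g :: "'i \<Rightarrow> nat \<Rightarrow> real"
  assumes "finite I"
  shows "\<exists>r. strict_mono r \<and> (\<forall>i\<in>I. convergent (\<lambda>n. g i (r n)) \<or>
    filterlim (\<lambda>n. g i (r n)) at_top sequentially \<or> filterlim (\<lambda>n. g i (r n)) at_bot sequentially)"
proof -
  obtain r where r: "strict_mono r" "\<forall>i\<in>I. \<exists>l. (\<lambda>n. ereal (g i (r n))) \<longlonglongrightarrow> l"
    using common_subsequence_extended_limits[OF assms] by blast
  have "convergent (\<lambda>n. g i (r n)) \<or>
    filterlim (\<lambda>n. g i (r n)) at_top sequentially \<or> filterlim (\<lambda>n. g i (r n)) at_bot sequentially"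
    if "i \<in> I" for i
  proof -
    from bspec[OF r(2) that] obtain l where l: "(\<lambda>n. ereal (g i (r n))) \<longlonglongrightarrow> l" ..
    show ?thesis
    proof (cases l)
      case (real x)
      then show ?thesis using l by (auto simp: convergent_def)
    next
      case PInf
      then show ?thesis using l by (simp add: tendsto_PInfty_eq_at_top)
    next
      case MInf
      then have "(\<lambda>n. - ereal (g i (r n))) \<longlonglongrightarrow> \<infinity>" using tendsto_uminus_ereal[OF l] by simp
      then show ?thesis by (simp add: tendsto_PInfty_eq_at_top filterlim_uminus_at_bot)
    qed
  qed
  then show ?thesis using r(1) by blast
qed

subsection \<open>Entries of a solution by order of magnitude\<close>

text \<open>A bounded integer multiple of \<open>R n\<close> has factor 0 as soon as
  \<open>R n\<close> exceeds the bound.\<close>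

lemma tendsto_integer_multiples_zero:
  fixes R :: "nat \<Rightarrow> real" and z :: "nat \<Rightarrow> int"
  assumes "filterlim R at_top sequentially" and "(\<lambda>n. R n * of_int (z n)) \<longlonglongrightarrow> l"
  shows "l = 0"
proof -
  have "(\<lambda>n. \<bar>R n * of_int (z n)\<bar>) \<longlonglongrightarrow> \<bar>l\<bar>" using assms(2) by (rule tendsto_rabs)
  then have "\<forall>\<^sub>F n in sequentially. \<bar>R n * of_int (z n)\<bar> < \<bar>l\<bar> + 1"
    by (rule order_tendstoD) simp
  moreover have "\<forall>\<^sub>F n in sequentially. \<bar>l\<bar> + 1 \<le> R n"
    using assms(1) by (auto simp: filterlim_at_top)
  ultimately have "\<forall>\<^sub>F n in sequentially. R n * of_int (z n) = 0"
  proof eventually_elim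
    case (elim n)
    show ?case
    proof (rule ccontr)
      assume "R n * of_int (z n) \<noteq> 0"
      then have "1 \<le> \<bar>of_int (z n) :: real\<bar>" by auto
      then have "R n * 1 \<le> R n * \<bar>of_int (z n)\<bar>" using elim(2) by (intro mult_left_mono) auto
      with elim show False by (simp add: abs_mult)
    qed
  qed
  then have "(\<lambda>n. R n * of_int (z n)) \<longlonglongrightarrow> 0" by (rule tendsto_eventually)
  with assms(2) show ?thesis by (rule LIMSEQ_unique)
qed

text \<open>Logarithms of entries of one block are known only up to integer multiples of the period \<open>R n\<close>.
  Since \<open>R\<close> tends to infinity, a limit of differences modulo this period is nevertheless unique.\<close>

definition phase_diff :: "(nat \<Rightarrow> real) \<Rightarrow> (nat \<Rightarrow> real) \<Rightarrow> (nat \<Rightarrow> real) \<Rightarrow> real \<Rightarrow> bool" where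
  "phase_diff R f g l \<longleftrightarrow> (\<exists>z :: nat \<Rightarrow> int. (\<lambda>n. f n - g n + R n * of_int (z n)) \<longlonglongrightarrow> l)"

lemma phase_diff_refl: "phase_diff R f f 0"
  unfolding phase_diff_def by (intro exI[of _ "\<lambda>_. 0"]) simp

lemma phase_diff_diff:
  assumes "phase_diff R f h l" "phase_diff R g h l'"
  shows "phase_diff R f g (l - l')"
proof -
  obtain z z' where "(\<lambda>n. f n - h n + R n * of_int (z n)) \<longlonglongrightarrow> l"
    "(\<lambda>n. g n - h n + R n * of_int (z' n)) \<longlonglongrightarrow> l'"
    using assms unfolding phase_diff_def by blast
  from tendsto_diff[OF this] show ?thesis
    unfolding phase_diff_def by (intro exI[of _ "\<lambda>n. z n - z' n"]) (simp add: algebra_simps)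
qed

lemma phase_diff_sym: "phase_diff R f g l \<Longrightarrow> phase_diff R g f (- l)"
  using phase_diff_diff[OF phase_diff_refl[of R g], of f l] by simp

lemma phase_diff_trans:
  "phase_diff R f g l \<Longrightarrow> phase_diff R g h l' \<Longrightarrow> phase_diff R f h (l + l')"
  using phase_diff_diff[of R f g l h "- l'"] phase_diff_sym[of R g h l'] by simp

lemma phase_diff_unique:
  assumes "filterlim R at_top sequentially" "phase_diff R f g l" "phase_diff R f g l'"
  shows "l = l'"
proof -
  obtain z z' where "(\<lambda>n. f n - g n + R n * of_int (z n)) \<longlonglongrightarrow> l"
    "(\<lambda>n. f n - g n + R n * of_int (z' n)) \<longlonglongrightarrow> l'"
    using assms(2,3) unfolding phase_diff_def by blast
  from tendsto_diff[OF this] have "(\<lambda>n. R n * of_int (z n - z' n)) \<longlonglongrightarrow> l - l'"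
    by (simp add: algebra_simps)
  with assms(1) have "l - l' = 0" by (rule tendsto_integer_multiples_zero)
  then show ?thesis by simp
qed

text \<open>Having a phase difference is an equivalence relation, and \<open>\<delta>\<close>
  measures each sequence against a chosen representative of its class. Additivity and uniqueness
  turn differences of \<open>\<delta>\<close> into phase differences.\<close>

lemma phase_potential:
  assumes R: "filterlim R at_top sequentially"
  shows "\<exists>\<delta>. \<forall>f g l. phase_diff R f g l \<longrightarrow> \<delta> f - \<delta> g = l"
proof -
  define rep where "rep f = (SOME h. \<exists>l. phase_diff R f h l)" for f
  have "\<exists>l. phase_diff R f (rep f) l" for f
    unfolding rep_def by (rule someI[of _ f]) (use phase_diff_refl in blast)
  then obtain \<delta> where \<delta>: "phase_diff R f (rep f) (\<delta> f)" for f by metis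
  have "\<delta> f - \<delta> g = l" if fg: "phase_diff R f g l" for f g l
  proof -
    \<comment> \<open>Equivalent sequences present the same predicate to \<open>SOME\<close>, hence
      share their representative.\<close>
    have "(\<exists>l. phase_diff R f h l) \<longleftrightarrow> (\<exists>l. phase_diff R g h l)" for h
      using phase_diff_trans[OF fg] phase_diff_trans[OF phase_diff_sym[OF fg]] by blast
    then have "rep f = rep g" unfolding rep_def by simp
    then have "phase_diff R f g (\<delta> f - \<delta> g)"
      using phase_diff_diff[OF \<delta>[of f], of g "\<delta> g"] \<delta>[of g] by simp
    then show ?thesis using phase_diff_unique[OF R _ fg] by blast
  qed
  then show ?thesis by blast
qed

section \<open>Orders of magnitude on the logarithmic scale\<close>

definition dominates :: "(nat \<Rightarrow> real) \<Rightarrow> (nat \<Rightarrow> real) \<Rightarrow> bool" where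
  "dominates f g \<longleftrightarrow> filterlim (\<lambda>n. f n - g n) at_top sequentially"

lemma dominates_trans: "dominates f g \<Longrightarrow> dominates g h \<Longrightarrow> dominates f h"
  unfolding dominates_def by (drule (1) filterlim_at_top_add_at_top) simp

lemma not_dominates_refl: "\<not> dominates f f"
  unfolding dominates_def using filterlim_at_top_dense[of "\<lambda>_::nat. 0::real"]
  by (auto dest: spec[of _ 1])

lemma dominates_cong:
  assumes "convergent (\<lambda>n. f n - g n)"
  shows "dominates f h \<longleftrightarrow> dominates g h"
proof -
  obtain l where l: "(\<lambda>n. f n - g n) \<longlonglongrightarrow> l" using assms by (auto simp: convergent_def)
  then have l': "(\<lambda>n. g n - f n) \<longlonglongrightarrow> - l" using tendsto_minus by fastforce
  show ?thesis
    unfolding dominates_def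
    using filterlim_tendsto_add_at_top[OF l, of "\<lambda>n. g n - h n"]
      filterlim_tendsto_add_at_top[OF l', of "\<lambda>n. f n - h n"] by auto
qed

text \<open>The rank counts dominated members. A dominating sequence inherits everything the
  dominated one dominates and adds that sequence itself, so its rank is strictly larger; a
  convergent difference does not affect the count.\<close>

lemma ex_rank:
  assumes fin: "finite J"
    and tri: "\<And>i j. i \<in> J \<Longrightarrow> j \<in> J \<Longrightarrow>
      convergent (\<lambda>n. y i n - y j n) \<or> dominates (y i) (y j) \<or> dominates (y j) (y i)"
  shows "\<exists>\<rho> :: 'i \<Rightarrow> nat. \<forall>i\<in>J. \<forall>j\<in>J. (\<rho> i < \<rho> j \<longrightarrow> dominates (y j) (y i)) \<and>
    (\<rho> i = \<rho> j \<longrightarrow> convergent (\<lambda>n. y i n - y j n))"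
proof -
  define \<rho> where "\<rho> i = card {j \<in> J. dominates (y i) (y j)}" for i
  have less: "\<rho> j < \<rho> i" if "i \<in> J" "j \<in> J" "dominates (y i) (y j)" for i j
    unfolding \<rho>_def
  proof (rule psubset_card_mono)
    have "{k \<in> J. dominates (y j) (y k)} \<subseteq> {k \<in> J. dominates (y i) (y k)}"
      using that dominates_trans by blast
    moreover have "j \<in> {k \<in> J. dominates (y i) (y k)} - {k \<in> J. dominates (y j) (y k)}"
      using that not_dominates_refl by blast
    ultimately show "{k \<in> J. dominates (y j) (y k)} \<subset> {k \<in> J. dominates (y i) (y k)}" by blast
  qed (use fin in simp)
  have eq: "\<rho> i = \<rho> j" if "convergent (\<lambda>n. y i n - y j n)" for i j
    unfolding \<rho>_def using dominates_cong[OF that] by simp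
  show ?thesis
  proof (intro exI[of _ \<rho>] ballI conjI impI)
    fix i j assume ij: "i \<in> J" "j \<in> J"
    show "dominates (y j) (y i)" if "\<rho> i < \<rho> j"
      using tri[OF ij] less[OF ij] eq[of i j] that by auto
    show "convergent (\<lambda>n. y i n - y j n)" if "\<rho> i = \<rho> j"
      using tri[OF ij] less[OF ij] less[OF ij(2,1)] that by auto
  qed
qed

text \<open>By \<open>fredholm_alternative\<close> it suffices that a functional vanishing on all
  columns of rank above \<open>s\<close> also vanishes on the weighted sum of rank \<open>s\<close>.
  On the scale of one entry of rank \<open>s\<close>, terms of lower rank tend to 0 and those of
  higher rank carry the factor 0, so the limit can be taken term by term.\<close>

lemma asymptotic_columns_condition:
  fixes a :: "'i \<Rightarrow> nat \<Rightarrow> real" and y :: "'i \<Rightarrow> nat \<Rightarrow> real"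
  assumes fin: "finite J" and R: "filterlim R at_top sequentially"
    and same: "\<And>i j. i \<in> J \<Longrightarrow> j \<in> J \<Longrightarrow> \<tau> i = \<tau> j \<Longrightarrow> phase_diff R (y i) (y j) 0"
    and tri: "\<And>i j. i \<in> J \<Longrightarrow> j \<in> J \<Longrightarrow>
      convergent (\<lambda>n. y i n - y j n) \<or> dominates (y i) (y j) \<or> dominates (y j) (y i)"
    and sol: "\<And>n w. w < u \<Longrightarrow> (\<Sum>i\<in>J. a i w * exp (y i n)) = 0"
  shows "\<exists>d (\<rho> :: 'i \<Rightarrow> nat) q. (\<forall>i. 0 < d i) \<and> (\<forall>i\<in>J. \<forall>j\<in>J. \<tau> i = \<tau> j \<longrightarrow> d i = d j) \<and>
    (\<forall>s. \<forall>w<u. (\<Sum>i | i \<in> J \<and> \<rho> i = s. d i * a i w) = (\<Sum>i | i \<in> J \<and> s < \<rho> i. q s i * a i w))"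
proof -
  obtain \<delta>' where \<delta>': "\<And>f g l. phase_diff R f g l \<Longrightarrow> \<delta>' f - \<delta>' g = l"
    using phase_potential[OF R] by blast
  define \<delta> where "\<delta> i = \<delta>' (y i)" for i
  obtain \<rho> :: "'i \<Rightarrow> nat" where
    \<rho>_less: "\<And>i j. i \<in> J \<Longrightarrow> j \<in> J \<Longrightarrow> \<rho> i < \<rho> j \<Longrightarrow> dominates (y j) (y i)" and
    \<rho>_eq: "\<And>i j. i \<in> J \<Longrightarrow> j \<in> J \<Longrightarrow> \<rho> i = \<rho> j \<Longrightarrow> convergent (\<lambda>n. y i n - y j n)"
    using ex_rank[where J = J and y = y, OF fin tri] by blast
  have lim_eq: "(\<lambda>n. exp (y i n - y j n)) \<longlonglongrightarrow> exp (\<delta> i - \<delta> j)" if "i \<in> J" "j \<in> J" "\<rho> i = \<rho> j" for i j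
  proof -
    from \<rho>_eq[OF that] obtain l where l: "(\<lambda>n. y i n - y j n) \<longlonglongrightarrow> l"
      by (auto simp: convergent_def)
    \<comment> \<open>A plain limit is a phase difference with all integers 0, so within one rank
      the potential gives the true limit.\<close>
    then have "phase_diff R (y i) (y j) l"
      unfolding phase_diff_def by (intro exI[of _ "\<lambda>_. 0"]) simp
    then have "\<delta> i - \<delta> j = l" unfolding \<delta>_def by (rule \<delta>')
    then show ?thesis using tendsto_exp[OF l] by simp
  qed
  have lim_less: "(\<lambda>n. exp (y i n - y j n)) \<longlonglongrightarrow> 0" if "i \<in> J" "j \<in> J" "\<rho> i < \<rho> j" for i j
  proof -
    have "filterlim (\<lambda>n. - (y j n - y i n)) at_bot sequentially"
      using \<rho>_less[OF that] unfolding dominates_def filterlim_uminus_at_top by simp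
    then show ?thesis using filterlim_compose[OF exp_at_bot] by simp
  qed
  have "\<exists>q. \<forall>w<u. (\<Sum>i | i \<in> J \<and> \<rho> i = s. exp (\<delta> i) * a i w) = (\<Sum>i | i \<in> J \<and> s < \<rho> i. q i * a i w)" for s
  proof (cases "\<exists>i\<in>J. \<rho> i = s")
    case False
    then have "{i. i \<in> J \<and> \<rho> i = s} = {}" by blast
    then show ?thesis by (intro exI[of _ "\<lambda>_. 0"]) (simp only: sum.empty mult_zero_left sum.neutral_const simp_thms)
  next
    case True
    then obtain k where k: "k \<in> J" "\<rho> k = s" by blast
    define v where "v w = (\<Sum>i | i \<in> J \<and> \<rho> i = s. exp (\<delta> i) * a i w)" for w
    have "(\<Sum>w<u. f w * v w) = 0" if f: "\<forall>i\<in>{i. i \<in> J \<and> s < \<rho> i}. (\<Sum>w<u. f w * a i w) = 0" for f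
    proof -
      define F where "F i = (\<Sum>w<u. f w * a i w)" for i
      have "(\<Sum>i\<in>J. F i * exp (y i n - y k n)) = 0" for n
      proof -
        have "(\<Sum>i\<in>J. F i * exp (y i n - y k n)) = (\<Sum>i\<in>J. \<Sum>w<u. exp (- y k n) * (f w * (a i w * exp (y i n))))"
          unfolding F_def sum_distrib_right
          by (intro sum.cong refl) (simp add: exp_diff exp_minus field_simps)
        also have "\<dots> = (\<Sum>w<u. exp (- y k n) * (f w * (\<Sum>i\<in>J. a i w * exp (y i n))))"
          by (subst sum.swap) (simp add: sum_distrib_left)
        also have "\<dots> = 0" using sol by simp
        finally show ?thesis .
      qed
      moreover have "(\<lambda>n. \<Sum>i\<in>J. F i * exp (y i n - y k n)) \<longlonglongrightarrow>
          (\<Sum>i\<in>J. F i * (if \<rho> i = s then exp (\<delta> i - \<delta> k) else 0))"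
      proof (rule tendsto_sum)
        fix i assume i: "i \<in> J"
        consider "\<rho> i = s" | "\<rho> i < s" | "s < \<rho> i" by linarith
        then show "(\<lambda>n. F i * exp (y i n - y k n)) \<longlonglongrightarrow> F i * (if \<rho> i = s then exp (\<delta> i - \<delta> k) else 0)"
        proof cases
          case 1
          then show ?thesis using tendsto_mult_left[OF lim_eq[OF i k(1)], of "F i"] k(2) by simp
        next
          case 2
          then show ?thesis using tendsto_mult_left[OF lim_less[OF i k(1)], of "F i"] k(2) by simp
        next
          case 3
          then have "F i = 0" using f i by (simp add: F_def)
          then show ?thesis by simp
        qed
      qed
      ultimately have "(\<Sum>i\<in>J. F i * (if \<rho> i = s then exp (\<delta> i - \<delta> k) else 0)) = 0"
        by (simp add: LIMSEQ_const_iff)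
      then have "0 = (\<Sum>i\<in>J. if \<rho> i = s then F i * exp (\<delta> i - \<delta> k) else 0)"
        by (simp add: if_distrib cong: if_cong)
      also have "\<dots> = (\<Sum>i | i \<in> J \<and> \<rho> i = s. F i * exp (\<delta> i - \<delta> k))"
        using fin by (simp add: sum.inter_filter)
      also have "\<dots> = (\<Sum>i | i \<in> J \<and> \<rho> i = s. F i * exp (\<delta> i)) / exp (\<delta> k)"
        by (simp add: exp_diff sum_divide_distrib)
      finally have "(\<Sum>i | i \<in> J \<and> \<rho> i = s. F i * exp (\<delta> i)) = 0" by simp
      moreover have "(\<Sum>w<u. f w * v w) = (\<Sum>i | i \<in> J \<and> \<rho> i = s. F i * exp (\<delta> i))"
        unfolding v_def F_def sum_distrib_left sum_distrib_right
        by (subst sum.swap) (simp add: mult_ac)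
      ultimately show ?thesis by simp
    qed
    moreover have "finite {i. i \<in> J \<and> s < \<rho> i}" using fin by simp
    ultimately show ?thesis
      using fredholm_alternative[of "{i. i \<in> J \<and> s < \<rho> i}" u v a] unfolding v_def by blast
  qed
  then have "\<exists>q. \<forall>s. \<forall>w<u. (\<Sum>i | i \<in> J \<and> \<rho> i = s. exp (\<delta> i) * a i w) = (\<Sum>i | i \<in> J \<and> s < \<rho> i. q s i * a i w)"
    by (intro choice allI)
  then obtain q where q: "\<forall>s. \<forall>w<u. (\<Sum>i | i \<in> J \<and> \<rho> i = s. exp (\<delta> i) * a i w) = (\<Sum>i | i \<in> J \<and> s < \<rho> i. q s i * a i w)" ..
  have tag: "exp (\<delta> i) = exp (\<delta> j)" if "i \<in> J" "j \<in> J" "\<tau> i = \<tau> j" for i j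
    using \<delta>'[OF same[OF that]] by (simp add: \<delta>_def)
  show ?thesis
    by (intro exI[of _ "\<lambda>i. exp (\<delta> i)"] exI[of _ \<rho>] exI[of _ q] conjI allI[of "\<lambda>i. 0 < exp (\<delta> i)"] ballI impI exp_gt_zero tag q)
qed

subsection \<open>Regularity with independent colours is regularity after rescaling\<close>

text \<open>The logarithmic axis is cut into cells of length \<open>1 / k\<close> and numbered with
  period \<open>k\<close>, that is, with \<open>k * k\<close> cells. Equal residues therefore
  determine the difference modulo \<open>k\<close> up to \<open>1 / k\<close>: as \<open>k\<close>
  grows, the error vanishes while the period tends to infinity.\<close>

lemma log_scale_colouring:
  assumes "\<lfloor>N * s\<rfloor> mod (int k)\<^sup>2 = \<lfloor>N * t\<rfloor> mod (int k)\<^sup>2" "N = real k" "0 < k"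
  shows "\<exists>z::int. \<bar>s - t + N * of_int z\<bar> \<le> 1 / N"
proof -
  obtain z where z: "\<lfloor>N * s\<rfloor> - \<lfloor>N * t\<rfloor> = (int k)\<^sup>2 * z"
    using assms(1) by (metis mod_eq_dvd_iff dvdE)
  have "of_int \<lfloor>N * s\<rfloor> - of_int \<lfloor>N * t\<rfloor> = N\<^sup>2 * of_int z"
    using arg_cong[OF z, of real_of_int] assms(2) by simp
  then have "\<bar>N * s - N * t - N\<^sup>2 * of_int z\<bar> \<le> 1"
    by linarith
  moreover have "N * s - N * t - N\<^sup>2 * of_int z = (s - t + N * of_int (- z)) * N"
    by (simp add: algebra_simps power2_eq_square)
  moreover have "0 < N" using assms(2,3) by simp
  ultimately have "\<bar>s - t + N * of_int (- z)\<bar> \<le> 1 / N" by (simp only: abs_mult abs_of_pos pos_le_divide_eq)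
  then show ?thesis by blast
qed

lemma regular_system_imp_columns_condition:
  fixes a :: "'i \<Rightarrow> nat \<Rightarrow> rat" and \<tau> :: "'i \<Rightarrow> 't"
  assumes fin: "finite J" and reg: "regular_system u J \<tau> a"
  shows "\<exists>d (\<rho> :: 'i \<Rightarrow> nat) q. (\<forall>i. 0 < d i) \<and> (\<forall>i\<in>J. \<forall>j\<in>J. \<tau> i = \<tau> j \<longrightarrow> d i = d j) \<and>
    (\<forall>s. \<forall>w<u. (\<Sum>i | i \<in> J \<and> \<rho> i = s. d i * of_rat (a i w)) =
      (\<Sum>i | i \<in> J \<and> s < \<rho> i. q s i * (of_rat (a i w) :: real)))"
proof -
  define col where "col n x = \<lfloor>real (Suc n) * ln (real x)\<rfloor> mod (int (Suc n))\<^sup>2" for n x :: nat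
  have "\<exists>x. (\<forall>i\<in>J. 0 < x i) \<and> (\<forall>i\<in>J. \<forall>j\<in>J. \<tau> i = \<tau> j \<longrightarrow> col n (x i) = col n (x j)) \<and>
      (\<forall>w<u. (\<Sum>i\<in>J. a i w * of_nat (x i)) = 0)" for n
  proof (rule regular_system_finite_range[OF reg])
    have "col n x \<in> {0..<(int (Suc n))\<^sup>2}" for x
      unfolding col_def by (simp del: of_nat_Suc)
    then have "col n ` {1..} \<subseteq> {0..<(int (Suc n))\<^sup>2}" by blast
    then show "finite (col n ` {1..})" by (rule finite_subset) simp
  qed
  then have "\<exists>x. \<forall>n. (\<forall>i\<in>J. 0 < x n i) \<and> (\<forall>i\<in>J. \<forall>j\<in>J. \<tau> i = \<tau> j \<longrightarrow> col n (x n i) = col n (x n j)) \<and>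
      (\<forall>w<u. (\<Sum>i\<in>J. a i w * of_nat (x n i)) = 0)"
    by (intro choice allI)
  then obtain x where x_pos: "\<And>n i. i \<in> J \<Longrightarrow> 0 < x n i"
    and x_col: "\<And>n i j. i \<in> J \<Longrightarrow> j \<in> J \<Longrightarrow> \<tau> i = \<tau> j \<Longrightarrow> col n (x n i) = col n (x n j)"
    and x_sol: "\<And>n w. w < u \<Longrightarrow> (\<Sum>i\<in>J. a i w * of_nat (x n i)) = 0"
    by blast
  define Y where "Y i n = ln (real (x n i))" for i n
  have "finite (J \<times> J)" using fin by simp
  from common_subsequence_limits[OF this, of "\<lambda>p n. Y (fst p) n - Y (snd p) n"]
  obtain r where r: "strict_mono (r :: nat \<Rightarrow> nat)" and lim: "\<forall>p\<in>J \<times> J.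
      convergent (\<lambda>n. Y (fst p) (r n) - Y (snd p) (r n)) \<or>
      filterlim (\<lambda>n. Y (fst p) (r n) - Y (snd p) (r n)) at_top sequentially \<or>
      filterlim (\<lambda>n. Y (fst p) (r n) - Y (snd p) (r n)) at_bot sequentially" by blast
  \<comment> \<open>The period of the colouring used at step \<open>n\<close> of the
    subsequence.\<close>
  define R where "R n = real (Suc (r n))" for n
  have R: "filterlim R at_top sequentially"
    unfolding R_def
    by (rule filterlim_compose[OF filterlim_real_sequentially])
      (rule filterlim_compose[OF filterlim_Suc filterlim_subseq[OF r]])
  define y where "y i n = Y i (r n)" for i n
  show ?thesis
  proof (rule asymptotic_columns_condition[OF fin R])
    show "phase_diff R (y i) (y j) 0" if "i \<in> J" "j \<in> J" "\<tau> i = \<tau> j" for i j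
    proof -
      have "\<exists>z::int. \<bar>y i n - y j n + R n * of_int z\<bar> \<le> 1 / R n" for n
        using log_scale_colouring[OF x_col[OF that, of "r n", unfolded col_def] refl] unfolding y_def Y_def R_def by simp
      then obtain z :: "nat \<Rightarrow> int" where z: "\<bar>y i n - y j n + R n * of_int (z n)\<bar> \<le> 1 / R n" for n
        by metis
      have "(\<lambda>n. 1 / R n) \<longlonglongrightarrow> 0"
        using tendsto_inverse_0_at_top[OF R] by (simp add: inverse_eq_divide)
      then have "(\<lambda>n. y i n - y j n + R n * of_int (z n)) \<longlonglongrightarrow> 0"
        by (rule tendsto_0_le[where K = 1]) (use z in \<open>auto simp: R_def\<close>)
      then show ?thesis unfolding phase_diff_def by blast
    qed
    show "convergent (\<lambda>n. y i n - y j n) \<or> dominates (y i) (y j) \<or> dominates (y j) (y i)"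
      if "i \<in> J" "j \<in> J" for i j
    proof -
      have "(i, j) \<in> J \<times> J" using that by simp
      from bspec[OF lim this] show ?thesis
        by (simp add: y_def dominates_def filterlim_uminus_at_bot)
    qed
    show "(\<Sum>i\<in>J. of_rat (a i w) * exp (y i n)) = 0" if "w < u" for n w
    proof -
      have "(\<Sum>i\<in>J. of_rat (a i w) * exp (y i n)) = (\<Sum>i\<in>J. of_rat (a i w * of_nat (x (r n) i)))"
        using x_pos by (intro sum.cong) (auto simp: y_def Y_def of_rat_mult)
      also have "\<dots> = of_rat (\<Sum>i\<in>J. a i w * of_nat (x (r n) i))" by (simp add: of_rat_sum)
      finally show ?thesis using x_sol[OF that] by simp
    qed
  qed
qed

text \<open>Equality on a tag and each coordinate of each class condition are rational relations
  among the entries of one vector \<open>\<omega>\<close>, indexed by a disjoint sum. The ranks stay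
  fixed; only the numbers are approximated.\<close>

lemma rational_columns_condition:
  fixes a :: "'i \<Rightarrow> nat \<Rightarrow> rat" and \<tau> :: "'i \<Rightarrow> 't" and d :: "'i \<Rightarrow> real" and \<rho> :: "'i \<Rightarrow> nat"
  assumes fin: "finite J" and d: "\<And>i. 0 < d i"
    and same: "\<And>i j. i \<in> J \<Longrightarrow> j \<in> J \<Longrightarrow> \<tau> i = \<tau> j \<Longrightarrow> d i = d j"
    and cc: "\<And>s w. w < u \<Longrightarrow> (\<Sum>i | i \<in> J \<and> \<rho> i = s. d i * of_rat (a i w)) =
      (\<Sum>i | i \<in> J \<and> s < \<rho> i. q s i * of_rat (a i w))"
  shows "\<exists>(d' :: 'i \<Rightarrow> rat) q'. (\<forall>i\<in>J. 0 < d' i) \<and> (\<forall>i\<in>J. \<forall>j\<in>J. \<tau> i = \<tau> j \<longrightarrow> d' i = d' j) \<and>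
    (\<forall>s. \<forall>w<u. (\<Sum>i | i \<in> J \<and> \<rho> i = s. d' i * a i w) = (\<Sum>i | i \<in> J \<and> s < \<rho> i. q' s i * a i w))"
proof -
  define m where "m = Suc (Max (insert 0 (\<rho> ` J)))"
  have m: "\<rho> i < m" if "i \<in> J" for i
    using fin that unfolding m_def by (simp add: less_Suc_eq_le)
  define W where "W = J <+> ({..<m} \<times> J)"
  have finW: "finite W" using fin by (simp add: W_def)
  define \<omega> where "\<omega> = case_sum d (\<lambda>(s, i). q s i)"
  \<comment> \<open>A tolerance no larger than any weight keeps the approximations positive; the
    inserted 1 covers empty \<open>J\<close>.\<close>
  define \<epsilon> where "\<epsilon> = Min (insert 1 (d ` J))"
  have \<epsilon>: "0 < \<epsilon>" unfolding \<epsilon>_def using fin d by (subst Min_gr_iff) auto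
  obtain \<omega>' :: "'i + nat \<times> 'i \<Rightarrow> rat" where near: "\<And>p. p \<in> W \<Longrightarrow> \<bar>of_rat (\<omega>' p) - \<omega> p\<bar> < \<epsilon>"
    and rel: "\<And>c :: 'i + nat \<times> 'i \<Rightarrow> rat. (\<Sum>p\<in>W. of_rat (c p) * \<omega> p) = 0 \<Longrightarrow> (\<Sum>p\<in>W. c p * \<omega>' p) = 0"
    using rational_approximation_preserving_relations[OF finW \<epsilon>, of \<omega>] by blast
  define d' where "d' i = \<omega>' (Inl i)" for i
  define q' where "q' s i = \<omega>' (Inr (s, i))" for s i
  have split: "(\<Sum>p\<in>W. h p) = (\<Sum>i\<in>J. h (Inl i)) + (\<Sum>s<m. \<Sum>i\<in>J. h (Inr (s, i)))"
    for h :: "'i + nat \<times> 'i \<Rightarrow> 'b::comm_monoid_add"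
    unfolding W_def using fin by (simp add: sum.Plus sum.cartesian_product)
  have pos: "0 < d' i" if "i \<in> J" for i
  proof -
    have W: "Inl i \<in> W" using that by (auto simp: W_def)
    have "\<epsilon> \<le> d i" unfolding \<epsilon>_def using fin that by (intro Min_le) auto
    moreover have "\<bar>of_rat (d' i) - d i\<bar> < \<epsilon>"
      using near[OF W] by (simp add: d'_def \<omega>_def)
    ultimately have "0 < (of_rat (d' i) :: real)" by linarith
    then show ?thesis by simp
  qed
  have tag: "d' i = d' j" if ij: "i \<in> J" "j \<in> J" "\<tau> i = \<tau> j" for i j
  proof -
    define c :: "'i + nat \<times> 'i \<Rightarrow> rat" where
      "c = case_sum (\<lambda>k. (if k = i then 1 else 0) - (if k = j then 1 else 0)) (\<lambda>_. 0)"
    have "(\<Sum>p\<in>W. of_rat (c p) * \<omega> p) = d i - d j"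
      unfolding split using ij fin
      by (simp add: c_def \<omega>_def of_rat_diff left_diff_distrib sum_subtractf if_distrib[of of_rat]
          if_distrib[of "\<lambda>x. x * _"] cong: if_cong)
    then have "(\<Sum>p\<in>W. c p * \<omega>' p) = 0" using same[OF ij] by (intro rel) simp
    moreover have "(\<Sum>p\<in>W. c p * \<omega>' p) = d' i - d' j"
      unfolding split using ij fin
      by (simp add: c_def d'_def left_diff_distrib sum_subtractf if_distrib[of "\<lambda>x. x * _"] cong: if_cong)
    ultimately show ?thesis by simp
  qed
  have "(\<Sum>i | i \<in> J \<and> \<rho> i = s. d' i * a i w) = (\<Sum>i | i \<in> J \<and> s < \<rho> i. q' s i * a i w)"
    if w: "w < u" for s w
  proof (cases "s < m")
    case False
    then have "{i. i \<in> J \<and> \<rho> i = s} = {}" "{i. i \<in> J \<and> s < \<rho> i} = {}" using m by fastforce+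
    then show ?thesis by (simp only: sum.empty)
  next
    case True
    \<comment> \<open>The relation obtained by moving both sides of the condition for class
      \<open>s\<close> and coordinate \<open>w\<close> to one side.\<close>
    define c :: "'i + nat \<times> 'i \<Rightarrow> rat" where
      "c = case_sum (\<lambda>i. if \<rho> i = s then a i w else 0)
        (\<lambda>(t, i). if t = s then (if s < \<rho> i then - a i w else 0) else 0)"
    have c: "c (Inl i) = (if \<rho> i = s then a i w else 0)"
      "c (Inr (t, i)) = (if t = s then (if s < \<rho> i then - a i w else 0) else 0)" for i t
      by (simp_all add: c_def)
    have inner: "(\<Sum>t<m. \<Sum>i\<in>J. (if t = s then (if s < \<rho> i then h i else 0) else 0) * g t i)
        = (\<Sum>i | i \<in> J \<and> s < \<rho> i. h i * g s i)" for h :: "'i \<Rightarrow> 'f::field" and g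
    proof -
      have "(\<Sum>t<m. \<Sum>i\<in>J. (if t = s then (if s < \<rho> i then h i else 0) else 0) * g t i)
          = (\<Sum>t<m. if t = s then (\<Sum>i\<in>J. (if s < \<rho> i then h i else 0) * g t i) else 0)"
        by (intro sum.cong) auto
      also have "\<dots> = (\<Sum>i\<in>J. if s < \<rho> i then h i * g s i else 0)"
        using True by (simp add: if_distrib[of "\<lambda>x. x * _"] cong: if_cong)
      also have "\<dots> = (\<Sum>i | i \<in> J \<and> s < \<rho> i. h i * g s i)"
        using fin by (simp add: sum.inter_filter)
      finally show ?thesis .
    qed
    have outer: "(\<Sum>i\<in>J. (if \<rho> i = s then h i else 0) * g i) = (\<Sum>i | i \<in> J \<and> \<rho> i = s. h i * g i)"
      for h g :: "'i \<Rightarrow> 'f::field"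
      using fin by (simp add: sum.inter_filter if_distrib[of "\<lambda>x. x * _"] cong: if_cong)
    have "(\<Sum>p\<in>W. of_rat (c p) * \<omega> p) = (\<Sum>i | i \<in> J \<and> \<rho> i = s. of_rat (a i w) * d i)
        + (\<Sum>i | i \<in> J \<and> s < \<rho> i. - of_rat (a i w) * q s i)"
      unfolding split c if_distrib[of of_rat] of_rat_0 of_rat_minus outer inner by (simp add: \<omega>_def)
    also have "\<dots> = 0" using cc[OF w, of s] by (simp add: sum_negf mult.commute)
    finally have "(\<Sum>p\<in>W. c p * \<omega>' p) = 0" by (rule rel)
    then have "(\<Sum>i | i \<in> J \<and> \<rho> i = s. a i w * d' i) + (\<Sum>i | i \<in> J \<and> s < \<rho> i. - a i w * q' s i) = 0"
      unfolding split c outer inner by (simp add: d'_def q'_def)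
    then show ?thesis by (simp add: sum_negf mult.commute)
  qed
  with pos tag show ?thesis by (intro exI[of _ d'] exI[of _ q'] conjI ballI allI impI)
qed

theorem regular_system_iff_rescaling:
  fixes a :: "'i \<Rightarrow> nat \<Rightarrow> rat" and \<tau> :: "'i \<Rightarrow> 't"
  assumes fin: "finite J"
  shows "regular_system u J \<tau> a \<longleftrightarrow>
    (\<exists>d :: 't \<Rightarrow> rat. (\<forall>t. 0 < d t) \<and> regular_system u J (\<lambda>_. ()) (\<lambda>i w. d (\<tau> i) * a i w))"
proof
  assume "regular_system u J \<tau> a"
  from regular_system_imp_columns_condition[OF fin this]
  obtain \<delta> and \<rho> :: "'i \<Rightarrow> nat" and p where \<delta>: "\<forall>i. 0 < \<delta> i"
    "\<forall>i\<in>J. \<forall>j\<in>J. \<tau> i = \<tau> j \<longrightarrow> \<delta> i = \<delta> j"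
    "\<forall>s. \<forall>w<u. (\<Sum>i | i \<in> J \<and> \<rho> i = s. \<delta> i * of_rat (a i w)) =
      (\<Sum>i | i \<in> J \<and> s < \<rho> i. p s i * (of_rat (a i w) :: real))" by (elim exE conjE)
  have "\<exists>(e :: 'i \<Rightarrow> rat) q. (\<forall>i\<in>J. 0 < e i) \<and> (\<forall>i\<in>J. \<forall>j\<in>J. \<tau> i = \<tau> j \<longrightarrow> e i = e j) \<and>
    (\<forall>s. \<forall>w<u. (\<Sum>i | i \<in> J \<and> \<rho> i = s. e i * a i w) = (\<Sum>i | i \<in> J \<and> s < \<rho> i. q s i * a i w))"
    by (rule rational_columns_condition[where d = \<delta> and \<tau> = \<tau> and \<rho> = \<rho> and a = a and q = p, OF fin]) (use \<delta> in blast)+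
  then obtain e q where e: "\<And>i. i \<in> J \<Longrightarrow> 0 < e i" "\<And>i j. i \<in> J \<Longrightarrow> j \<in> J \<Longrightarrow> \<tau> i = \<tau> j \<Longrightarrow> e i = e j"
    "\<And>s w. w < u \<Longrightarrow> (\<Sum>i | i \<in> J \<and> \<rho> i = s. e i * a i w) = (\<Sum>i | i \<in> J \<and> s < \<rho> i. q s i * a i w)"
    by blast
  \<comment> \<open>As \<open>e\<close> is constant on each tag, any preimage yields the weight of
    \<open>t\<close>; tags without columns get the positive default 1.\<close>
  define d where "d t = (if t \<in> \<tau> ` J then e (inv_into J \<tau> t) else 1)" for t
  have d: "d (\<tau> i) = e i" if "i \<in> J" for i
    using that e(2)[of "inv_into J \<tau> (\<tau> i)" i] by (simp add: d_def inv_into_into f_inv_into_f)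
  have "0 < d t" for t using e(1) by (auto simp: d_def inv_into_into)
  moreover have "regular_system u J (\<lambda>_. ()) (\<lambda>i w. d (\<tau> i) * a i w)"
  proof (rule columns_condition_imp_regular_system[OF fin])
    fix s w assume w: "w < u"
    have "(\<Sum>i | i \<in> J \<and> \<rho> i = s. d (\<tau> i) * a i w) = (\<Sum>i | i \<in> J \<and> \<rho> i = s. e i * a i w)"
      by (intro sum.cong) (auto simp: d)
    also have "\<dots> = (\<Sum>i | i \<in> J \<and> s < \<rho> i. q s i * a i w)" by (rule e(3)[OF w])
    \<comment> \<open>The columns of higher rank are weighted too, so their coefficients are divided
      by the weights.\<close>
    also have "\<dots> = (\<Sum>i | i \<in> J \<and> s < \<rho> i. q s i / e i * (d (\<tau> i) * a i w))"
    proof (intro sum.cong refl)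
      fix i assume "i \<in> {i. i \<in> J \<and> s < \<rho> i}"
      then show "q s i * a i w = q s i / e i * (d (\<tau> i) * a i w)" using e(1)[of i] by (simp add: d)
    qed
    finally show "(\<Sum>i | i \<in> J \<and> \<rho> i = s. d (\<tau> i) * a i w)
        = (\<Sum>i | i \<in> J \<and> s < \<rho> i. q s i / e i * (d (\<tau> i) * a i w))" .
  qed
  ultimately show "\<exists>d :: 't \<Rightarrow> rat. (\<forall>t. 0 < d t) \<and> regular_system u J (\<lambda>_. ()) (\<lambda>i w. d (\<tau> i) * a i w)"
    by blast
next
  assume "\<exists>d :: 't \<Rightarrow> rat. (\<forall>t. 0 < d t) \<and> regular_system u J (\<lambda>_. ()) (\<lambda>i w. d (\<tau> i) * a i w)"
  then show "regular_system u J \<tau> a" using regular_system_rescale[OF fin] by blast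
qed

subsection \<open>Matrices\<close>

text \<open>Matches flat positions in a concatenation with pairs of block number and offset, so that
  the columns of a block matrix and those of the tuple get corresponding index sets.\<close>

lemma concat_index_bijection:
  "\<exists>h. bij_betw h {..<length (concat Ls)} (SIGMA t:{..<length Ls}. {..<length (Ls ! t)}) \<and>
    (\<forall>n<length (concat Ls). concat Ls ! n = Ls ! fst (h n) ! snd (h n))"
proof (induction Ls rule: rev_induct)
  case Nil
  show ?case by (simp add: bij_betw_def)
next
  case (snoc l Ls)
  let ?N = "length (concat Ls)"
  obtain h where bij: "bij_betw h {..<?N} (SIGMA t:{..<length Ls}. {..<length (Ls ! t)})"
    and nth: "\<forall>n<?N. concat Ls ! n = Ls ! fst (h n) ! snd (h n)"
    using snoc.IH by blast
  define g where "g n = (if n < ?N then h n else (length Ls, n - ?N))" for n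
  have h_lt: "fst (h n) < length Ls" if "n < ?N" for n
    using bij_betwE[OF bij] that by (metis SigmaE fst_conv lessThan_iff)
  have "bij_betw g {..<?N} (SIGMA t:{..<length Ls}. {..<length (Ls ! t)})"
    using bij by (rule bij_betw_cong[THEN iffD1, rotated]) (simp add: g_def)
  moreover have "bij_betw g {?N..<?N + length l} ({length Ls} \<times> {..<length l})"
    by (rule bij_betw_byWitness[where f' = "\<lambda>p. ?N + snd p"]) (auto simp: g_def)
  ultimately have "bij_betw g ({..<?N} \<union> {?N..<?N + length l})
      ((SIGMA t:{..<length Ls}. {..<length (Ls ! t)}) \<union> {length Ls} \<times> {..<length l})"
    by (rule bij_betw_combine) auto
  moreover have "{..<?N} \<union> {?N..<?N + length l} = {..<length (concat (Ls @ [l]))}" by auto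
  moreover have "(SIGMA t:{..<length Ls}. {..<length (Ls ! t)}) \<union> {length Ls} \<times> {..<length l} =
      (SIGMA t:{..<length (Ls @ [l])}. {..<length ((Ls @ [l]) ! t)})"
    by (auto simp: nth_append less_Suc_eq split: if_splits)
  ultimately have "bij_betw g {..<length (concat (Ls @ [l]))}
      (SIGMA t:{..<length (Ls @ [l])}. {..<length ((Ls @ [l]) ! t)})" by simp
  moreover have "concat (Ls @ [l]) ! n = (Ls @ [l]) ! fst (g n) ! snd (g n)"
    if "n < length (concat (Ls @ [l]))" for n
    using that nth h_lt by (auto simp: g_def nth_append)
  ultimately show ?case by blast
qed

section \<open>Relabelling and scaling of regular systems\<close>

lemma regular_system_reindex:
  assumes h: "bij_betw h I J"
    and a: "\<And>i w. i \<in> I \<Longrightarrow> w < u \<Longrightarrow> b i w = a (h i) w"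
    and \<tau>: "\<And>i. i \<in> I \<Longrightarrow> \<sigma> i = \<tau> (h i)"
    and reg: "regular_system u J \<tau> a"
  shows "regular_system u I \<sigma> b"
  unfolding regular_system_def
proof (intro allI impI)
  fix r \<phi>
  assume "finite_colouring r \<phi>"
  then obtain x where x: "\<forall>i\<in>J. 0 < x i" "\<forall>i\<in>J. \<forall>j\<in>J. \<tau> i = \<tau> j \<longrightarrow> \<phi> (x i) = \<phi> (x j)"
    "\<forall>w<u. (\<Sum>i\<in>J. a i w * of_nat (x i)) = 0"
    using reg[unfolded regular_system_def] by blast
  have hJ: "h i \<in> J" if "i \<in> I" for i using bij_betwE[OF h] that by blast
  have pos: "0 < x (h i)" if "i \<in> I" for i using x(1) hJ[OF that] by blast
  have col: "\<phi> (x (h i)) = \<phi> (x (h j))" if "i \<in> I" "j \<in> I" "\<sigma> i = \<sigma> j" for i j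
  proof -
    have "\<tau> (h i) = \<tau> (h j)" using \<tau> that by simp
    then show ?thesis using x(2) hJ that(1,2) by blast
  qed
  have sol: "(\<Sum>i\<in>I. b i w * of_nat (x (h i))) = 0" if "w < u" for w
  proof -
    have "(\<Sum>i\<in>I. b i w * of_nat (x (h i))) = (\<Sum>i\<in>I. a (h i) w * of_nat (x (h i)))"
      using a that by (intro sum.cong) auto
    also have "\<dots> = (\<Sum>i\<in>J. a i w * of_nat (x i))" by (rule sum.reindex_bij_betw[OF h])
    finally show ?thesis using x(3) that by simp
  qed
  show "\<exists>x. (\<forall>i\<in>I. 0 < x i) \<and> (\<forall>i\<in>I. \<forall>j\<in>I. \<sigma> i = \<sigma> j \<longrightarrow> \<phi> (x i) = \<phi> (x j)) \<and>
      (\<forall>w<u. (\<Sum>i\<in>I. b i w * of_nat (x i)) = 0)"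
    by (intro exI[of _ "\<lambda>i. x (h i)"] conjI ballI allI impI pos col sol)
qed

lemma regular_system_reindex_iff:
  assumes h: "bij_betw h I J"
    and a: "\<And>i w. i \<in> I \<Longrightarrow> w < u \<Longrightarrow> b i w = a (h i) w"
    and \<tau>: "\<And>i. i \<in> I \<Longrightarrow> \<sigma> i = \<tau> (h i)"
  shows "regular_system u I \<sigma> b \<longleftrightarrow> regular_system u J \<tau> a"
proof
  have inv: "inv_into I h j \<in> I" "h (inv_into I h j) = j" if "j \<in> J" for j
    using h that by (auto simp: bij_betw_def inv_into_into f_inv_into_f)
  assume "regular_system u I \<sigma> b"
  then show "regular_system u J \<tau> a"
    by (rule regular_system_reindex[OF bij_betw_inv_into[OF h], rotated -1]) (simp_all add: a \<tau> inv)
qed (rule regular_system_reindex[where a = a and b = b and \<tau> = \<tau> and \<sigma> = \<sigma>, OF h a \<tau>])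

text \<open>Serves to normalise the weight of the first block to 1.\<close>

lemma regular_system_scale:
  assumes "regular_system u J \<tau> a"
  shows "regular_system u J \<tau> (\<lambda>i w. c * a i w)"
proof -
  have eq: "(\<Sum>i\<in>J. c * a i w * of_nat (x i)) = c * (\<Sum>i\<in>J. a i w * of_nat (x i))" for w x
    by (simp add: sum_distrib_left mult.assoc)
  show ?thesis
    unfolding regular_system_def eq
  proof (intro allI impI)
    fix r \<phi>
    assume "finite_colouring r \<phi>"
    from assms[unfolded regular_system_def, THEN spec, THEN spec, THEN mp, OF this]
    obtain x where "\<forall>i\<in>J. 0 < x i" "\<forall>i\<in>J. \<forall>j\<in>J. \<tau> i = \<tau> j \<longrightarrow> \<phi> (x i) = \<phi> (x j)"
      and sol: "\<forall>w<u. (\<Sum>i\<in>J. a i w * of_nat (x i)) = 0" by (elim exE conjE)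
    moreover have "\<forall>w<u. c * (\<Sum>i\<in>J. a i w * of_nat (x i)) = 0" using sol by simp
    ultimately show "\<exists>x. (\<forall>i\<in>J. 0 < x i) \<and> (\<forall>i\<in>J. \<forall>j\<in>J. \<tau> i = \<tau> j \<longrightarrow> \<phi> (x i) = \<phi> (x j)) \<and>
        (\<forall>w<u. c * (\<Sum>i\<in>J. a i w * of_nat (x i)) = 0)"
      by (intro exI[of _ x] conjI)
  qed
qed

section \<open>Matrix equations as regular systems\<close>

lemma mult_mat_vec_eq_0_iff:
  fixes M :: "rat mat"
  assumes "x \<in> carrier_vec (dim_col M)"
  shows "M *\<^sub>v map_vec of_nat x = 0\<^sub>v (dim_row M) \<longleftrightarrow>
    (\<forall>w<dim_row M. (\<Sum>i<dim_col M. M $$ (w, i) * of_nat (x $ i)) = 0)"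
proof -
  have "(M *\<^sub>v map_vec of_nat x) $ w = (\<Sum>i<dim_col M. M $$ (w, i) * of_nat (x $ i))" if "w < dim_row M" for w
    using assms that by (auto simp: scalar_prod_def atLeast0LessThan intro!: sum.cong)
  then show ?thesis by (auto simp: vec_eq_iff)
qed

lemma kernel_partition_regular_iff_regular_system:
  "kernel_partition_regular M \<longleftrightarrow>
    regular_system (dim_row M) {..<dim_col M} (\<lambda>_. ()) (\<lambda>i w. M $$ (w, i))"
proof -
  have "(\<exists>x \<in> carrier_vec (dim_col M). positive_vec x \<and> monochromatic \<phi> x \<and>
        M *\<^sub>v map_vec of_nat x = 0\<^sub>v (dim_row M)) \<longleftrightarrow>
      (\<exists>x. (\<forall>i\<in>{..<dim_col M}. 0 < x i) \<and>
        (\<forall>i\<in>{..<dim_col M}. \<forall>j\<in>{..<dim_col M}. () = () \<longrightarrow> \<phi> (x i) = \<phi> (x j)) \<and>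
        (\<forall>w<dim_row M. (\<Sum>i<dim_col M. M $$ (w, i) * of_nat (x i)) = 0))" (is "?L \<longleftrightarrow> ?R") for \<phi>
  proof
    assume ?L
    then obtain x where x: "x \<in> carrier_vec (dim_col M)" "positive_vec x" "monochromatic \<phi> x"
      "M *\<^sub>v map_vec of_nat x = 0\<^sub>v (dim_row M)" by blast
    have "\<forall>w<dim_row M. (\<Sum>i<dim_col M. M $$ (w, i) * of_nat (x $ i)) = 0"
      using x(4) mult_mat_vec_eq_0_iff[OF x(1)] by blast
    then show ?R
      using x(1-3) by (intro exI[of _ "\<lambda>i. x $ i"]) (auto simp: positive_vec_def monochromatic_def)
  next
    assume ?R
    then obtain x where x: "\<forall>i<dim_col M. 0 < x i"
      "\<forall>i<dim_col M. \<forall>j<dim_col M. \<phi> (x i) = \<phi> (x j)"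
      "\<forall>w<dim_row M. (\<Sum>i<dim_col M. M $$ (w, i) * of_nat (x i)) = 0"
      unfolding lessThan_iff Ball_def by blast
    define X where "X = vec (dim_col M) x"
    have X: "X \<in> carrier_vec (dim_col M)" by (simp add: X_def)
    have "monochromatic \<phi> X"
      unfolding monochromatic_def
    proof (intro exI allI impI)
      fix i assume "i < dim_vec X"
      then have i: "i < dim_col M" by (simp add: X_def)
      then have "\<phi> (x i) = \<phi> (x 0)" using x(2) by (metis gr_zeroI not_less_zero)
      then show "\<phi> (X $ i) = \<phi> (x 0)" using i by (simp add: X_def)
    qed
    moreover have "M *\<^sub>v map_vec of_nat X = 0\<^sub>v (dim_row M)"
      using x(3) by (simp add: mult_mat_vec_eq_0_iff[OF X]) (simp add: X_def)
    moreover have "positive_vec X" using x(1) by (simp add: positive_vec_def X_def)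
    ultimately show ?L using X by blast
  qed
  then show ?thesis unfolding kernel_partition_regular_def regular_system_def by simp
qed

lemma multiply_kernel_partition_regular_iff_regular_system:
  assumes A: "\<And>t. t \<in> {1..k} \<Longrightarrow> A t \<in> carrier_mat u (v t)"
  shows "multiply_kernel_partition_regular u k A \<longleftrightarrow>
    regular_system u (SIGMA t:{1..k}. {..<v t}) fst (\<lambda>(t, i) w. A t $$ (w, i))"
proof -
  let ?J = "SIGMA t:{1..k}. {..<v t}"
  have carr: "A t *\<^sub>v map_vec of_nat (x t) \<in> carrier_vec u"
    if "\<And>t. t \<in> {1..k} \<Longrightarrow> x t \<in> carrier_vec (v t)" "t \<in> {1..k}" for x :: "nat \<Rightarrow> nat vec" and t
    using A[OF that(2)] that(1)[OF that(2)] by (simp add: mult_mat_vec_carrier)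
  have sum_eq: "finsum_vec TYPE(rat) u (\<lambda>t. A t *\<^sub>v map_vec of_nat (x t)) {1..k} $ w =
      (\<Sum>(t, i)\<in>?J. A t $$ (w, i) * of_nat (x t $ i))"
    if x: "\<And>t. t \<in> {1..k} \<Longrightarrow> x t \<in> carrier_vec (v t)" and w: "w < u" for x :: "nat \<Rightarrow> nat vec" and w
  proof -
    have "finsum_vec TYPE(rat) u (\<lambda>t. A t *\<^sub>v map_vec of_nat (x t)) {1..k} $ w =
        (\<Sum>t\<in>{1..k}. (A t *\<^sub>v map_vec of_nat (x t)) $ w)"
      using w by (intro index_finsum_vec Pi_I) (auto intro: carr[OF x])
    also have "\<dots> = (\<Sum>t\<in>{1..k}. \<Sum>i<v t. A t $$ (w, i) * of_nat (x t $ i))"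
    proof (rule sum.cong[OF refl])
      fix t assume t: "t \<in> {1..k}"
      then show "(A t *\<^sub>v map_vec of_nat (x t)) $ w = (\<Sum>i<v t. A t $$ (w, i) * of_nat (x t $ i))"
        using A[OF t] x[OF t] w by (auto simp: scalar_prod_def atLeast0LessThan intro!: sum.cong)
    qed
    also have "\<dots> = (\<Sum>(t, i)\<in>?J. A t $$ (w, i) * of_nat (x t $ i))" by (subst sum.Sigma) auto
    finally show ?thesis .
  qed
  have dimv: "dim_vec (finsum_vec TYPE(rat) u (\<lambda>t. A t *\<^sub>v map_vec of_nat (x t)) {1..k}) = u"
    if x: "\<And>t. t \<in> {1..k} \<Longrightarrow> x t \<in> carrier_vec (v t)" for x
    by (rule carrier_vecD, rule finsum_vec_closed, rule Pi_I, rule carr[OF x])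
  have iff: "(\<exists>x :: nat \<Rightarrow> nat vec.
        (\<forall>t\<in>{1..k}. x t \<in> carrier_vec (dim_col (A t)) \<and> positive_vec (x t) \<and>
          monochromatic \<phi> (x t)) \<and>
        finsum_vec TYPE(rat) u (\<lambda>t. A t *\<^sub>v map_vec of_nat (x t)) {1..k} = 0\<^sub>v u) \<longleftrightarrow>
      (\<exists>x. (\<forall>i\<in>?J. 0 < x i) \<and> (\<forall>i\<in>?J. \<forall>j\<in>?J. fst i = fst j \<longrightarrow> \<phi> (x i) = \<phi> (x j)) \<and>
        (\<forall>w<u. (\<Sum>i\<in>?J. (case i of (t, i) \<Rightarrow> \<lambda>w. A t $$ (w, i)) w * of_nat (x i)) = 0))"
    (is "?L \<longleftrightarrow> ?R") for \<phi>
  proof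
    assume ?L
    then obtain x where x: "\<And>t. t \<in> {1..k} \<Longrightarrow> x t \<in> carrier_vec (v t)"
      "\<And>t. t \<in> {1..k} \<Longrightarrow> positive_vec (x t)" "\<And>t. t \<in> {1..k} \<Longrightarrow> monochromatic \<phi> (x t)"
      and sol: "finsum_vec TYPE(rat) u (\<lambda>t. A t *\<^sub>v map_vec of_nat (x t)) {1..k} = 0\<^sub>v u"
      using A by (metis carrier_matD(2))
    have dim: "dim_vec (x t) = v t" if "t \<in> {1..k}" for t using x(1)[OF that] by simp
    show ?R
    proof (intro exI[of _ "\<lambda>(t, i). x t $ i"] conjI ballI allI impI)
      fix p assume "p \<in> ?J"
      then show "0 < (case p of (t, i) \<Rightarrow> x t $ i)"
        using x(2) dim by (auto simp: positive_vec_def)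
    next
      fix p p' assume "p \<in> ?J" "p' \<in> ?J" "fst p = fst p'"
      then obtain t i j where p: "p = (t, i)" "p' = (t, j)" "t \<in> {1..k}" "i < v t" "j < v t" by auto
      obtain c where "\<forall>i<dim_vec (x t). \<phi> (x t $ i) = c"
        using x(3)[OF p(3)] by (auto simp: monochromatic_def)
      then show "\<phi> (case p of (t, i) \<Rightarrow> x t $ i) = \<phi> (case p' of (t, i) \<Rightarrow> x t $ i)"
        using p dim[OF p(3)] by simp
    next
      fix w assume w: "w < u"
      have "(\<Sum>(t, i)\<in>?J. A t $$ (w, i) * of_nat (x t $ i)) = 0"
        using sum_eq[OF x(1) w] sol w by simp
      then show "(\<Sum>p\<in>?J. (case p of (t, i) \<Rightarrow> \<lambda>w. A t $$ (w, i)) w * of_nat (case p of (t, i) \<Rightarrow> x t $ i)) = 0"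
        by (simp add: case_prod_beta)
    qed
  next
    assume ?R
    then obtain x where R: "\<forall>p\<in>?J. 0 < x p" "\<forall>p\<in>?J. \<forall>p'\<in>?J. fst p = fst p' \<longrightarrow> \<phi> (x p) = \<phi> (x p')"
      "\<forall>w<u. (\<Sum>i\<in>?J. (case i of (t, i) \<Rightarrow> \<lambda>w. A t $$ (w, i)) w * of_nat (x i)) = 0"
      by (elim exE conjE)
    have x: "0 < x p" "p' \<in> ?J \<Longrightarrow> fst p = fst p' \<Longrightarrow> \<phi> (x p) = \<phi> (x p')" if "p \<in> ?J" for p p'
      using R(1,2) that by blast+
    have sol: "(\<Sum>i\<in>?J. (case i of (t, i) \<Rightarrow> \<lambda>w. A t $$ (w, i)) w * of_nat (x i)) = 0" if "w < u" for w
      using R(3) that by blast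
    define X where "X t = vec (v t) (\<lambda>i. x (t, i))" for t
    have X: "X t \<in> carrier_vec (v t)" for t by (simp add: X_def)
    have "X t \<in> carrier_vec (dim_col (A t)) \<and> positive_vec (X t) \<and> monochromatic \<phi> (X t)"
      if t: "t \<in> {1..k}" for t
    proof (intro conjI)
      show "X t \<in> carrier_vec (dim_col (A t))" using A[OF t] X by auto
      show "positive_vec (X t)" using x(1) t by (auto simp: positive_vec_def X_def)
      show "monochromatic \<phi> (X t)"
        unfolding monochromatic_def
      proof (intro exI allI impI)
        fix i assume "i < dim_vec (X t)"
        then have i: "i < v t" by (simp add: X_def)
        have "\<phi> (x (t, i)) = \<phi> (x (t, 0))" using i t by (intro x(2)) auto
        then show "\<phi> (X t $ i) = \<phi> (x (t, 0))" using i by (simp add: X_def)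
      qed
    qed
    moreover have "finsum_vec TYPE(rat) u (\<lambda>t. A t *\<^sub>v map_vec of_nat (X t)) {1..k} = 0\<^sub>v u"
    proof (rule eq_vecI)
      fix w assume "w < dim_vec (0\<^sub>v u :: rat vec)"
      then have w: "w < u" by simp
      have "(\<Sum>(t, i)\<in>?J. A t $$ (w, i) * of_nat (X t $ i)) =
          (\<Sum>i\<in>?J. (case i of (t, i) \<Rightarrow> \<lambda>w. A t $$ (w, i)) w * of_nat (x i))"
        by (intro sum.cong) (auto simp: X_def)
      then show "finsum_vec TYPE(rat) u (\<lambda>t. A t *\<^sub>v map_vec of_nat (X t)) {1..k} $ w = 0\<^sub>v u $ w"
        using sum_eq[OF X w] sol[OF w] w by simp
    qed (use dimv[OF X] in simp)
    ultimately show ?L by blast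
  qed
  show ?thesis unfolding multiply_kernel_partition_regular_def regular_system_def iff ..
qed

lemma block_row_kernel_partition_regular_iff:
  fixes A :: "nat \<Rightarrow> rat mat"
  assumes A: "\<And>t. t \<in> {1..k} \<Longrightarrow> A t \<in> carrier_mat u (v t)"
  shows "kernel_partition_regular (block_row u (map A [1..<Suc k])) \<longleftrightarrow>
    regular_system u (SIGMA t:{1..k}. {..<v t}) (\<lambda>_. ()) (\<lambda>(t, i) w. A t $$ (w, i))"
proof -
  define Ls where "Ls = map cols (map A [1..<Suc k])"
  have Ls: "length Ls = k" "Ls ! t = cols (A (Suc t))" if "t < k" for t
    using that by (simp_all add: Ls_def del: upt_Suc)
  have lenLs: "length Ls = k" by (simp add: Ls_def del: upt_Suc)
  obtain h where h: "bij_betw h {..<length (concat Ls)} (SIGMA t:{..<length Ls}. {..<length (Ls ! t)})"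
    and nth: "\<forall>n<length (concat Ls). concat Ls ! n = Ls ! fst (h n) ! snd (h n)"
    using concat_index_bijection by blast
  have len: "length (Ls ! t) = v (Suc t)" if "t < k" for t
    using Ls(2)[OF that] A[of "Suc t"] that by simp
  \<comment> \<open>The list numbers its blocks from 0, the tuple from 1.\<close>
  have shift: "bij_betw (\<lambda>(t, i). (Suc t, i)) (SIGMA t:{..<length Ls}. {..<length (Ls ! t)}) (SIGMA t:{1..k}. {..<v t})"
    by (rule bij_betw_byWitness[where f' = "\<lambda>(t, i). (t - 1, i)"]) (auto simp: lenLs len)
  have M: "block_row u (map A [1..<Suc k]) = mat_of_cols u (concat Ls)"
    by (simp add: block_row_def Ls_def)
  show ?thesis
    unfolding kernel_partition_regular_iff_regular_system M mat_of_cols_carrier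
  proof (rule regular_system_reindex_iff[OF bij_betw_trans[OF h shift]])
    fix n w assume n: "n \<in> {..<length (concat Ls)}" and w: "w < u"
    obtain t i where ti: "h n = (t, i)" by force
    have "h n \<in> (SIGMA t:{..<length Ls}. {..<length (Ls ! t)})" using bij_betwE[OF h] n by blast
    then have t: "t < k" and i: "i < v (Suc t)" using ti len by (auto simp: lenLs)
    have "mat_of_cols u (concat Ls) $$ (w, n) = cols (A (Suc t)) ! i $ w"
      using n w nth ti Ls(2)[OF t] by (simp add: mat_of_cols_index)
    also have "\<dots> = A (Suc t) $$ (w, i)" using A[of "Suc t"] t i w by auto
    finally show "mat_of_cols u (concat Ls) $$ (w, n) =
        (case ((\<lambda>(t, i). (Suc t, i)) \<circ> h) n of (t, i) \<Rightarrow> \<lambda>w. A t $$ (w, i)) w"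
      by (simp add: ti)
  qed simp
qed

theorem theorem2p2:
  fixes u k :: nat and v :: "nat \<Rightarrow> nat" and A :: "nat \<Rightarrow> rat mat"
  assumes "0 < u" and "2 \<le> k"
    and "\<And>t. t \<in> {1..k} \<Longrightarrow> 0 < v t"
    and "\<And>t. t \<in> {1..k} \<Longrightarrow> A t \<in> carrier_mat u (v t)"
  shows "multiply_kernel_partition_regular u k A \<longleftrightarrow>
    (\<exists>c :: nat \<Rightarrow> rat. (\<forall>t\<in>{2..k}. 0 < c t) \<and>
      kernel_partition_regular
        (block_row u (A 1 # map (\<lambda>t. c t \<cdot>\<^sub>m A t) [2..<Suc k])))"
proof -
  let ?J = "SIGMA t:{1..k}. {..<v t}"
  let ?a = "\<lambda>(t, i) w. A t $$ (w, i)"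
  define reg where "reg d \<longleftrightarrow> regular_system u ?J (\<lambda>_. ()) (\<lambda>p w. d (fst p) * ?a p w)" for d
  have reg_cong: "reg d \<longleftrightarrow> reg d'" if "\<And>t. t \<in> {1..k} \<Longrightarrow> d t = d' t" for d d'
    unfolding reg_def
    by (rule regular_system_reindex_iff[OF bij_betw_id]) (use that in auto)
  \<comment> \<open>The first block carries no free factor; \<open>c(1 := 1)\<close> records it as
    weight 1, whatever \<open>c\<close> is at 1.\<close>
  have block: "kernel_partition_regular (block_row u (A 1 # map (\<lambda>t. c t \<cdot>\<^sub>m A t) [2..<Suc k]))
      \<longleftrightarrow> reg (c(1 := 1))" for c :: "nat \<Rightarrow> rat"
  proof -
    define B where "B t = (c(1 := 1)) t \<cdot>\<^sub>m A t" for t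
    have B: "B t \<in> carrier_mat u (v t)" if "t \<in> {1..k}" for t
      using assms(4)[OF that] by (simp add: B_def)
    have "[1..<Suc k] = 1 # [2..<Suc k]"
      using assms(2) by (simp add: upt_conv_Cons numeral_2_eq_2 del: upt_Suc)
    moreover have "B 1 = A 1"
      by (rule eq_matI) (auto simp: B_def)
    moreover have "map B [2..<Suc k] = map (\<lambda>t. c t \<cdot>\<^sub>m A t) [2..<Suc k]"
      by (rule map_cong) (auto simp: B_def)
    ultimately have "A 1 # map (\<lambda>t. c t \<cdot>\<^sub>m A t) [2..<Suc k] = map B [1..<Suc k]"
      by (simp only: list.map)
    then have "kernel_partition_regular (block_row u (A 1 # map (\<lambda>t. c t \<cdot>\<^sub>m A t) [2..<Suc k]))
        \<longleftrightarrow> regular_system u ?J (\<lambda>_. ()) (\<lambda>(t, i) w. B t $$ (w, i))"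
      using block_row_kernel_partition_regular_iff[OF B] by (simp only:)
    also have "\<dots> \<longleftrightarrow> reg (c(1 := 1))"
      unfolding reg_def
    proof (rule regular_system_reindex_iff[OF bij_betw_id])
      fix p w assume p: "p \<in> ?J" and w: "w < u"
      then obtain t i where ti: "p = (t, i)" "t \<in> {1..k}" "i < v t" by auto
      then show "(case p of (t, i) \<Rightarrow> \<lambda>w. B t $$ (w, i)) w = (c(1 := 1)) (fst (id p)) * ?a (id p) w"
        using assms(4)[OF ti(2)] w by (auto simp: B_def)
    qed simp
    finally show ?thesis .
  qed
  have "multiply_kernel_partition_regular u k A \<longleftrightarrow> regular_system u ?J fst ?a"
    using assms(4) by (rule multiply_kernel_partition_regular_iff_regular_system)
  also have "\<dots> \<longleftrightarrow> (\<exists>d. (\<forall>t. 0 < d t) \<and> reg d)"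
    unfolding reg_def by (rule regular_system_iff_rescaling) simp
  also have "\<dots> \<longleftrightarrow> (\<exists>c. (\<forall>t\<in>{2..k}. 0 < c t) \<and> reg (c(1 := 1)))"
  proof
    assume "\<exists>d. (\<forall>t. 0 < d t) \<and> reg d"
    then obtain d where d: "\<And>t. 0 < d t" "reg d" by blast
    \<comment> \<open>Only the ratios of the weights matter, so all of them are divided by
      \<open>d 1\<close>.\<close>
    have "reg (\<lambda>t. 1 / d 1 * d t)"
      using regular_system_scale[OF d(2)[unfolded reg_def], of "1 / d 1"]
      unfolding reg_def by (simp only: mult.assoc)
    moreover have "(\<lambda>t. 1 / d 1 * d t) = (\<lambda>t. 1 / d 1 * d t)(1 := 1)"
      using d(1)[of 1] by auto
    ultimately have "reg ((\<lambda>t. 1 / d 1 * d t)(1 := 1))" by (simp only:)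
    then show "\<exists>c. (\<forall>t\<in>{2..k}. 0 < c t) \<and> reg (c(1 := 1))"
      using d(1) by (intro exI[of _ "\<lambda>t. 1 / d 1 * d t"]) simp
  next
    assume "\<exists>c. (\<forall>t\<in>{2..k}. 0 < c t) \<and> reg (c(1 := 1))"
    then obtain c where c: "\<forall>t\<in>{2..k}. 0 < c t" "reg (c(1 := 1))" by blast
    \<comment> \<open>The weights must be positive at every index. The value 1 outside
      \<open>{2..k}\<close> achieves this and agrees with the prescribed weight of block 1.\<close>
    define d where "d t = (if t \<in> {2..k} then c t else 1)" for t
    have "reg d" using c(2) by (rule reg_cong[THEN iffD1, rotated]) (auto simp: d_def)
    moreover have "\<forall>t. 0 < d t" using c(1) by (simp add: d_def)
    ultimately show "\<exists>d. (\<forall>t. 0 < d t) \<and> reg d" by blast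
  qed
  finally show ?thesis unfolding block .
qed

end
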